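(* Let $G=(V,E)$ be a connected simple graph that contains at least one cycle of even length. Use the abbreviated notation $K:=K(\operatorname{line} G)$, and let $p$ be a prime for which the quantity $k(p) \geq 1$. Then for $G$ bipartite, one has $$K /p^{k(p)} K \cong {\mathbb Z}_{p^{k(p)}}^{\beta(G)-1} \oplus {\mathbb Z}_{\gcd(p^k, |V|)},$$ while for $G$ nonbipartite, one has $$K /p^{k(p)} K \cong {\mathbb Z}_{p^{k(p)}}^{\beta(G)-2} \oplus \begin{cases} 0 &\text{ if }p\text{ is odd,} \\ {\mathbb Z}_2^2 &\text{ if }p=2\text{ and }|V|\text{ is even,} \\ {\mathbb Z}_4 &\text{ if }p=2\text{ and }|V|\text{ is odd.} \end{cases}$$
   Context: $K(\cdot)$ denotes the critical group of a graph, ${\mathbb Z}_d={\mathbb Z}/d{\mathbb Z}$, $\beta(G)$ is the number of independent cycles of $G$, and $\operatorname{line} G$ is the line graph of $G$. For a prime $p$, $k(p)$ is the largest integer such that $p^{k(p)}$ divides $\deg_G(v)+\deg_G(w)$ for every edge $\{v,w\}\in E$. (In the bipartite formula, $p^k$ means $p^{k(p)}$.)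
   Formalization: In the nonbipartite case with p=2 and |V| odd, the summand Z_4 is replaced by Z_{gcd(2^{k(2)},4)}: this is Z_4 when k(2)≥2, but Z_2 when k(2)=1, where the printed claim is false because K/2K has exponent dividing 2. *)

theory Defs
  imports
    Complex_Main
    "HOL-Algebra.Free_Abelian_Groups"
    "HOL-Computational_Algebra.Primes"
    "HOL-Library.Function_Algebras"
    "HOL-Library.Z2"
begin

section \<open>Graphs\<close>

record 'a sgraph =
  vertices :: "'a set"
  edges :: "'a set set"

definition simple_graph :: "'a sgraph \<Rightarrow> bool" where
  "simple_graph G \<longleftrightarrow>
     finite (vertices G) \<and> (\<forall>e\<in>edges G. e \<subseteq> vertices G \<and> card e = 2)"

definition connected_graph :: "'a sgraph \<Rightarrow> bool" where
  "connected_graph G \<longleftrightarrow> vertices G \<noteq> {} \<and>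
     (\<forall>u\<in>vertices G. \<forall>v\<in>vertices G. (u, v) \<in> {(x, y). {x, y} \<in> edges G}\<^sup>*)"

definition bipartite_graph :: "'a sgraph \<Rightarrow> bool" where
  "bipartite_graph G \<longleftrightarrow>
     (\<exists>A B. A \<union> B = vertices G \<and> A \<inter> B = {} \<and>
            (\<forall>e\<in>edges G. \<exists>a\<in>A. \<exists>b\<in>B. e = {a, b}))"

definition vdegree :: "'a sgraph \<Rightarrow> 'a \<Rightarrow> nat" where
  "vdegree G v = card {e \<in> edges G. v \<in> e}"

definition line_graph :: "'a sgraph \<Rightarrow> 'a set sgraph" where
  "line_graph G = \<lparr> vertices = edges G,
     edges = {{e, f} | e f. e \<in> edges G \<and> f \<in> edges G \<and> e \<noteq> f \<and> e \<inter> f \<noteq> {}} \<rparr>"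

text \<open>A cycle is given by the list of its distinct vertices, in cyclic order; its length (number
  of edges) is the length of the list.\<close>

definition cycle_edges :: "'a list \<Rightarrow> 'a set set" where
  "cycle_edges c = (\<lambda>i. {c ! i, c ! (Suc i mod length c)}) ` {..<length c}"

definition is_cycle :: "'a sgraph \<Rightarrow> 'a list \<Rightarrow> bool" where
  "is_cycle G c \<longleftrightarrow> 3 \<le> length c \<and> distinct c \<and> cycle_edges c \<subseteq> edges G"

text \<open>The number of independent cycles is the dimension of the span of the cycles, regarded as
  indicator vectors of edge sets with coefficients in the field with two elements. (For a vector
  space, \<open>dim S\<close> is the dimension of the span of \<open>S\<close>, i.e. the size of a maximal independent
  subset of \<open>S\<close>.)\<close>

global_interpretation gf2: vector_space "\<lambda>(c::bit) (f::'e \<Rightarrow> bit) x. c * f x"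
  defines gf2_dim = gf2.dim
  by unfold_locales (auto simp: fun_eq_iff algebra_simps)

definition cyclomatic_number :: "'a sgraph \<Rightarrow> nat" where
  "cyclomatic_number G =
     gf2_dim ((\<lambda>c e. of_bool (e \<in> cycle_edges c)) ` {c. is_cycle G c})"

text \<open>The set of admissible \<open>k\<close> is bounded as soon as \<open>G\<close> has an edge and \<open>p \<ge> 2\<close>.\<close>

definition degree_sum_exponent :: "'a sgraph \<Rightarrow> nat \<Rightarrow> nat" where
  "degree_sum_exponent G p =
     (GREATEST k. \<forall>v w. {v, w} \<in> edges G \<longrightarrow> p ^ k dvd vdegree G v + vdegree G w)"


section \<open>The critical group\<close>

text \<open>The graph Laplacian as an endomorphism of the free abelian group on the vertices, and the
  critical group as the torsion subgroup of its cokernel. For connected \<open>G\<close> the cokernel is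
  the direct sum of \<open>\<int>\<close> and the critical group.\<close>

definition laplacian :: "'a sgraph \<Rightarrow> ('a \<Rightarrow>\<^sub>0 int) \<Rightarrow> ('a \<Rightarrow>\<^sub>0 int)" where
  "laplacian G = frag_extend (\<lambda>v. \<Sum>w | {v, w} \<in> edges G. frag_of v - frag_of w)"

definition laplacian_cokernel :: "'a sgraph \<Rightarrow> ('a \<Rightarrow>\<^sub>0 int) set monoid" where
  "laplacian_cokernel G =
     free_Abelian_group (vertices G) Mod
       (laplacian G ` carrier (free_Abelian_group (vertices G)))"

definition torsion_group :: "('g, 'm) monoid_scheme \<Rightarrow> ('g, 'm) monoid_scheme" where
  "torsion_group A =
     A \<lparr> carrier := {x \<in> carrier A. \<exists>n::nat. n > 0 \<and> x [^]\<^bsub>A\<^esub> n = \<one>\<^bsub>A\<^esub>} \<rparr>"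

definition critical_group :: "'a sgraph \<Rightarrow> ('a \<Rightarrow>\<^sub>0 int) set monoid" where
  "critical_group G = torsion_group (laplacian_cokernel G)"


section \<open>Abelian groups\<close>

text \<open>The quotient \<open>A / nA\<close>; the group is written multiplicatively, so \<open>nA\<close> is the
  subgroup of \<open>n\<close>-th powers.\<close>

definition quotient_by_multiples :: "('g, 'm) monoid_scheme \<Rightarrow> nat \<Rightarrow> 'g set monoid" where
  "quotient_by_multiples A n = A Mod ((\<lambda>x. x [^]\<^bsub>A\<^esub> n) ` carrier A)"

definition cyclic_power :: "nat \<Rightarrow> nat \<Rightarrow> (nat \<Rightarrow> int) monoid" where
  "cyclic_power n r = product_group {..<r} (\<lambda>_. integer_mod_group n)"

text \<open>Remark on the case \<open>p = 2\<close>, \<open>G\<close> nonbipartite, \<open>|V|\<close> odd. The summand \<open>\<int>\<^sub>4\<close> must be read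
  as \<open>\<int>\<^sub>4\<close> modulo \<open>2\<^sup>k\<close>, i.e. \<open>\<int>\<^sub>g\<close> with \<open>g = gcd(2\<^sup>k, 4)\<close>: for \<open>k \<ge> 2\<close> this is
  \<open>\<int>\<^sub>4\<close>, whereas for \<open>k = 1\<close> the group \<open>K / 2K\<close> has exponent dividing 2 and cannot contain
  \<open>\<int>\<^sub>4\<close>. The case \<open>k = 1\<close> occurs: glue two 4-cycles to a triangle, one at each of two of its
  vertices; then \<open>|V| = 9\<close>, \<open>\<beta> = 3\<close>, \<open>k = 1\<close>.\<close>

end

theory Submission
  imports Defs
begin

text \<open>Let \<open>N\<close> be the unsigned vertex-edge incidence matrix. The Laplacian of the line graph is
  \<open>diag (deg v + deg w) - N\<^sup>t N\<close>, so modulo \<open>q\<close> its cokernel is that of \<open>N\<^sup>t N\<close>. Since the image of \<open>N\<close>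
  is the root lattice \<open>A\<^sub>n\<^sub>-\<^sub>1\<close> (bipartite case) or \<open>D\<^sub>n\<close> (nonbipartite case), the cokernel of \<open>N\<^sup>t N\<close> is the
  sum of a free group, of rank \<open>\<beta>\<close> or \<open>\<beta> - 1\<close>, and the discriminant group of that lattice: \<open>\<int>\<^sub>n\<close>, and
  \<open>\<int>\<^sub>2\<^sup>2\<close> or \<open>\<int>\<^sub>4\<close> according to the parity of \<open>n\<close>. A spanning tree makes this explicit. On the other
  hand the cokernel of the Laplacian is the critical group plus a copy of \<open>\<int>\<close>, split off by the sum of
  the coefficients, so one factor \<open>\<int>\<^sub>q\<close> has to be cancelled; this is possible because \<open>\<int>\<^sub>q\<close> is a local
  ring. The even cycle guarantees that there is a free summand to cancel.\<close>

section \<open>Presentations of lattice quotients\<close>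

text \<open>Quotients are handled by linear functionals with moduli, which become a group
  homomorphism in one place only, \<open>quotient_critical_group_iso\<close>. The order of the
  reductions is forced: the images of the Laplacian and of N^t N are different lattices that
  coincide only after q Z^E is added, and on the enlarged lattice the coordinate sum is still
  divisible by q, as the cancellation requires. A vector x lies in the image of N^t N iff x = N^t y
  for some y in the image of N. Values off the tree decide whether y exists; the finite part of the
  cokernel decides whether y can be taken in the image of N. In the bipartite case y may be shifted
  by multiples of the sign vector s, the image of N is the orthogonal complement of s, and (s, s) =
  n produces Z_n. In the nonbipartite case y is unique, and two conditions modulo 2 arise: y has to
  be integral, although it differs from the tree potential by a possibly half-integral multiple of
  s, and its coordinate sum has to be even. The parity of n decides whether these two conditions are
  independent (Z_2^2) or fuse into one modulo 4 (Z_4).\<close>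

definition int_linear :: "(('e \<Rightarrow> int) \<Rightarrow> int) \<Rightarrow> bool" where
  "int_linear f \<longleftrightarrow> (\<forall>a b x y. f (\<lambda>e. a * x e + b * y e) = a * f x + b * f y)"

lemma int_linearD: "int_linear f \<Longrightarrow> f (\<lambda>e. a * x e + b * y e) = a * f x + b * f y"
  by (simp add: int_linear_def)

lemma int_linear_add: "int_linear f \<Longrightarrow> f (\<lambda>e. x e + y e) = f x + f y"
  using int_linearD[of f 1 x 1 y] by simp

lemma int_linear_add_cmult: "int_linear f \<Longrightarrow> f (\<lambda>e. x e + b * y e) = f x + b * f y"
  using int_linearD[of f 1 x b y] by simp

lemma int_linear_diff_cmult: "int_linear f \<Longrightarrow> f (\<lambda>e. x e - b * y e) = f x - b * f y"
  using int_linear_add_cmult[of f x "- b" y] by simp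

text \<open>The functionals \<open>f i\<close> modulo \<open>m i\<close> identify \<open>Z / (Z \<inter> \<Lambda>)\<close> with the product of the
  \<open>\<int> / m i\<close>; a modulus \<open>m i = 0\<close> stands for a factor \<open>\<int>\<close>.\<close>

definition presents ::
  "('e \<Rightarrow> int) set \<Rightarrow> ('e \<Rightarrow> int) set \<Rightarrow> 'i set \<Rightarrow> ('i \<Rightarrow> nat) \<Rightarrow> ('i \<Rightarrow> ('e \<Rightarrow> int) \<Rightarrow> int) \<Rightarrow> bool" where
  "presents Z \<Lambda> I m f \<longleftrightarrow>
     (\<forall>i\<in>I. int_linear (f i)) \<and>
     (\<forall>t. \<exists>x\<in>Z. \<forall>i\<in>I. int (m i) dvd f i x - t i) \<and>
     (\<forall>x\<in>Z. x \<in> \<Lambda> \<longleftrightarrow> (\<forall>i\<in>I. int (m i) dvd f i x))"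

lemma presentsI:
  assumes "\<And>i. i \<in> I \<Longrightarrow> int_linear (f i)"
    and "\<And>t. \<exists>x\<in>Z. \<forall>i\<in>I. int (m i) dvd f i x - t i"
    and "\<And>x. x \<in> Z \<Longrightarrow> x \<in> \<Lambda> \<longleftrightarrow> (\<forall>i\<in>I. int (m i) dvd f i x)"
  shows "presents Z \<Lambda> I m f"
  using assms by (simp add: presents_def)

lemma presents_linear: "presents Z \<Lambda> I m f \<Longrightarrow> i \<in> I \<Longrightarrow> int_linear (f i)"
  by (simp add: presents_def)

lemma presents_surj:
  assumes "presents Z \<Lambda> I m f"
  obtains x where "x \<in> Z" "\<And>i. i \<in> I \<Longrightarrow> int (m i) dvd f i x - t i"
  using assms unfolding presents_def by metis

lemma presents_iff:
  "presents Z \<Lambda> I m f \<Longrightarrow> x \<in> Z \<Longrightarrow> x \<in> \<Lambda> \<longleftrightarrow> (\<forall>i\<in>I. int (m i) dvd f i x)"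
  by (simp add: presents_def)

text \<open>Factor by factor, Z/m modulo q is Z/gcd(q, m). A free factor, encoded by
  \<open>m i = 0\<close>, becomes Z/q because \<open>gcd q 0 = q\<close>.\<close>

lemma presents_mod:
  assumes P: "presents UNIV \<Lambda> I m f"
  shows "presents UNIV {\<lambda>e. x e + int q * w e | x w. x \<in> \<Lambda>} I (\<lambda>i. gcd q (m i)) f"
proof (rule presentsI)
  fix t
  obtain x where "\<And>i. i \<in> I \<Longrightarrow> int (m i) dvd f i x - t i"
    using presents_surj[OF P] by blast
  then have "\<forall>i\<in>I. int (gcd q (m i)) dvd f i x - t i"
    by (meson dvd_trans gcd_dvd2 of_nat_dvd_iff)
  then show "\<exists>x\<in>UNIV. \<forall>i\<in>I. int (gcd q (m i)) dvd f i x - t i" by blast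
next
  fix x :: "'a \<Rightarrow> int"
  show "x \<in> {\<lambda>e. x e + int q * w e | x w. x \<in> \<Lambda>} \<longleftrightarrow> (\<forall>i\<in>I. int (gcd q (m i)) dvd f i x)"
  proof
    assume "x \<in> {\<lambda>e. x e + int q * w e | x w. x \<in> \<Lambda>}"
    then obtain y w where y: "y \<in> \<Lambda>" and x: "x = (\<lambda>e. y e + int q * w e)" by blast
    show "\<forall>i\<in>I. int (gcd q (m i)) dvd f i x"
    proof
      fix i assume i: "i \<in> I"
      have "int (m i) dvd f i y" using presents_iff[OF P, of y] y i by simp
      then have "int (gcd q (m i)) dvd f i y"
        by (meson dvd_trans gcd_dvd2 of_nat_dvd_iff)
      moreover have "int (gcd q (m i)) dvd int q * f i w"
        by (meson dvd_mult2 gcd_dvd1 of_nat_dvd_iff)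
      ultimately show "int (gcd q (m i)) dvd f i x"
        unfolding x int_linear_add_cmult[OF presents_linear[OF P i]] by (rule dvd_add)
    qed
  next
    assume R: "\<forall>i\<in>I. int (gcd q (m i)) dvd f i x"
    have "\<exists>b. int (m i) dvd f i x - int q * b" if "i \<in> I" for i
    proof -
      obtain c where c: "f i x = int (gcd q (m i)) * c" using R \<open>i \<in> I\<close> by blast
      obtain u v where "u * int q + v * int (m i) = gcd (int q) (int (m i))"
        using bezout_int by blast
      then have "f i x = (u * int q + v * int (m i)) * c" using c by simp
      then have "f i x - int q * (u * c) = int (m i) * (v * c)" by (simp add: algebra_simps)
      then show ?thesis by (metis dvd_triv_left)
    qed
    then obtain b where b: "\<And>i. i \<in> I \<Longrightarrow> int (m i) dvd f i x - int q * b i" by metis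
    \<comment> \<open>Surjectivity lifts the numbers \<open>b i\<close>, found for each functional
      separately, to a single vector \<open>w\<close>.\<close>
    obtain w where w: "\<And>i. i \<in> I \<Longrightarrow> int (m i) dvd f i w - b i"
      using presents_surj[OF P] by blast
    define y where "y = (\<lambda>e. x e - int q * w e)"
    have "int (m i) dvd f i y" if i: "i \<in> I" for i
    proof -
      have "f i y = (f i x - int q * b i) - int q * (f i w - b i)"
        unfolding y_def int_linear_diff_cmult[OF presents_linear[OF P i]] by (simp add: algebra_simps)
      then show ?thesis using b[OF i] w[OF i] by (metis dvd_diff dvd_mult)
    qed
    then have "y \<in> \<Lambda>" using presents_iff[OF P] by simp
    moreover have "x = (\<lambda>e. y e + int q * w e)" by (simp add: y_def)
    ultimately show "x \<in> {\<lambda>e. x e + int q * w e | x w. x \<in> \<Lambda>}" by blast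
  qed
qed (rule presents_linear[OF P])

lemma inverse_mod_prime_power:
  assumes "prime p" "\<not> int p dvd c"
  obtains u where "int (p ^ k) dvd 1 - u * c"
proof -
  have "coprime (int p ^ k) c"
    using assms by (simp add: prime_imp_coprime)
  then obtain u v where "u * c + v * int p ^ k = 1"
    using bezout_int[of c "int p ^ k"] by (metis coprime_imp_gcd_eq_1 gcd.commute)
  then have "1 - u * c = int (p ^ k) * v" by (simp add: algebra_simps)
  then show thesis using that by (metis dvd_triv_left)
qed

text \<open>The factor \<open>i0\<close> is traded for the condition \<open>deg x = 0\<close> by projecting along an element \<open>c\<close> on
  which \<open>deg\<close> and \<open>f i0\<close> are both prime to \<open>p\<close>; one of \<open>a\<close>, \<open>b\<close>, \<open>a + b\<close> is such an element.\<close>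

lemma presents_cancel:
  assumes P: "presents UNIV \<Lambda> I M f" and i0: "i0 \<in> I" "M i0 = q"
    and M: "\<And>i. i \<in> I \<Longrightarrow> M i dvd q"
    and q: "prime p" "q = p ^ k" "k \<ge> 1"
    and deg: "int_linear deg" "\<And>x. x \<in> \<Lambda> \<Longrightarrow> int q dvd deg x" "deg a = 1"
  shows "\<exists>g. presents {x. deg x = 0} \<Lambda> (I - {i0}) M g"
proof -
  note lin = presents_linear[OF P]
  have p1: "\<not> int p dvd 1" using prime_gt_1_nat[OF q(1)] by simp
  have pq: "int p dvd int q" using q by (simp add: dvd_power)
  obtain b where "int q dvd f i0 b - 1"
    using presents_surj[OF P, of "\<lambda>_. 1"] i0 by metis
  then have "int p dvd f i0 b - 1" using pq dvd_trans by blast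
  then have pb: "\<not> int p dvd f i0 b" using p1 dvd_diff_right_iff by blast
  have pa: "\<not> int p dvd deg a" using deg(3) p1 by simp
  have "\<exists>c. \<not> int p dvd deg c \<and> \<not> int p dvd f i0 c"
  proof (cases "int p dvd f i0 a \<and> int p dvd deg b")
    case True
    have "\<not> int p dvd deg (\<lambda>e. a e + b e)" "\<not> int p dvd f i0 (\<lambda>e. a e + b e)"
      using True pa pb by (simp_all add: int_linear_add[OF deg(1)] int_linear_add[OF lin[OF i0(1)]]
          dvd_add_left_iff dvd_add_right_iff)
    then show ?thesis by blast
  qed (use pa pb in blast)
  then obtain c where c: "\<not> int p dvd deg c" "\<not> int p dvd f i0 c" by blast
  obtain u where u: "int q dvd 1 - u * f i0 c"
    using inverse_mod_prime_power[OF q(1) c(2)] q(2) by blast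
  obtain s0 where s0: "int q dvd 1 - s0 * deg c"
    using inverse_mod_prime_power[OF q(1) c(1)] q(2) by blast
  \<comment> \<open>\<open>g i x\<close> is \<open>f i\<close> at
    \<open>x - (u * f i0 x) * c\<close>, the projection of \<open>x\<close> along \<open>c\<close>
    to the vectors on which \<open>f i0\<close> vanishes modulo \<open>q\<close>. In particular
    \<open>g i c\<close> vanishes modulo \<open>M i\<close>.\<close>
  define g where "g = (\<lambda>i x. f i x - u * f i0 x * f i c)"
  have "presents {x. deg x = 0} \<Lambda> (I - {i0}) M g"
  proof (rule presentsI)
    fix i assume i: "i \<in> I - {i0}"
    then show "int_linear (g i)"
      unfolding int_linear_def g_def using lin[of i] lin[OF i0(1)]
      by (auto simp: int_linearD algebra_simps)
  next
    fix t
    obtain w where w: "\<And>i. i \<in> I \<Longrightarrow> int (M i) dvd f i w - (if i = i0 then 0 else t i)"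
      using presents_surj[OF P, of "\<lambda>i. if i = i0 then 0 else t i"] by blast
    \<comment> \<open>Subtracting \<open>s * c\<close> makes the degree divisible by
      \<open>q\<close> without changing \<open>g i\<close> modulo \<open>M i\<close>. The remaining
      degree \<open>q * j\<close> is removed with \<open>a\<close>, of degree 1, and a multiple of
      \<open>q\<close> is invisible modulo \<open>M i\<close>.\<close>
    define s where "s = s0 * deg w"
    have "deg w - s * deg c = (1 - s0 * deg c) * deg w" by (simp add: s_def algebra_simps)
    then obtain j where j: "deg w - s * deg c = int q * j"
      using s0 by (metis dvd_def dvd_mult2)
    define x where "x = (\<lambda>e. (w e - s * c e) - (int q * j) * a e)"
    have "deg x = 0"
      unfolding x_def int_linear_diff_cmult[OF deg(1)] using j deg(3) by simp
    moreover have "int (M i) dvd g i x - t i" if i: "i \<in> I - {i0}" for i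
    proof -
      have f: "f i' x = f i' w - s * f i' c - int q * j * f i' a" if "i' \<in> I" for i'
        unfolding x_def int_linear_diff_cmult[OF lin[OF that]] by simp
      have iI: "i \<in> I" using i by simp
      have Mq: "int (M i) dvd int q" using M[OF iI] by simp
      have 1: "int (M i) dvd f i w - t i" using w[OF iI] i by simp
      have 2: "int (M i) dvd f i0 w" using w[OF i0(1)] i0(2) Mq dvd_trans by auto
      have 3: "int (M i) dvd 1 - u * f i0 c" using u Mq dvd_trans by blast
      have eq: "g i x - t i = (f i w - t i) - s * f i c * (1 - u * f i0 c) - int q * (j * f i a)
          - f i0 w * (u * f i c) + int q * (u * j * f i0 a * f i c)"
        unfolding g_def f[OF iI] f[OF i0(1)] by (simp add: algebra_simps)
      show ?thesis unfolding eq by (rule dvd_add[OF dvd_diff[OF dvd_diff[OF dvd_diff[OF 1]]]]) (use 2 3 Mq in auto)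
    qed
    ultimately show "\<exists>x\<in>{x. deg x = 0}. \<forall>i\<in>I - {i0}. int (M i) dvd g i x - t i" by blast
  next
    fix x assume "x \<in> {x. deg x = 0}"
    then have x0: "deg x = 0" by simp
    show "x \<in> \<Lambda> \<longleftrightarrow> (\<forall>i\<in>I - {i0}. int (M i) dvd g i x)"
    proof
      assume "x \<in> \<Lambda>"
      then have *: "\<And>i. i \<in> I \<Longrightarrow> int (M i) dvd f i x" using presents_iff[OF P] by simp
      show "\<forall>i\<in>I - {i0}. int (M i) dvd g i x"
      proof
        fix i assume i: "i \<in> I - {i0}"
        have "int (M i) dvd f i0 x"
          using *[OF i0(1)] i0(2) M[of i] i by (meson DiffD1 dvd_trans of_nat_dvd_iff)
        then show "int (M i) dvd g i x"
          using *[of i] i unfolding g_def by (simp add: dvd_diff)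
      qed
    next
      \<comment> \<open>The projection \<open>x - t * c\<close> lies in the lattice. Since
        \<open>deg x = 0\<close>, its degree is \<open>- t * deg c\<close>, which \<open>q\<close>
        must divide; \<open>deg c\<close> is a unit modulo \<open>q\<close>, so \<open>q\<close>
        divides \<open>t\<close> and \<open>t * c\<close> lies in the lattice as well.\<close>
      assume R: "\<forall>i\<in>I - {i0}. int (M i) dvd g i x"
      define t where "t = u * f i0 x"
      have "int (M i) dvd f i (\<lambda>e. x e - t * c e)" if i: "i \<in> I" for i
      proof (cases "i = i0")
        case True
        have "f i (\<lambda>e. x e - t * c e) = f i0 x * (1 - u * f i0 c)"
          unfolding int_linear_diff_cmult[OF lin[OF i]] using True by (simp add: t_def algebra_simps)
        then show ?thesis using u True i0(2) by simp
      next
        case False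
        then have "int (M i) dvd g i x" using R i by simp
        then show ?thesis unfolding int_linear_diff_cmult[OF lin[OF i]] by (simp add: g_def t_def)
      qed
      then have L: "(\<lambda>e. x e - t * c e) \<in> \<Lambda>" using presents_iff[OF P] by simp
      from deg(2)[OF L] have "int q dvd t * deg c"
        unfolding int_linear_diff_cmult[OF deg(1)] using x0 by simp
      moreover have "coprime (int q) (deg c)"
        using c(1) q by (simp add: prime_imp_coprime)
      ultimately have t: "int q dvd t" using coprime_dvd_mult_left_iff by blast
      have "int (M i) dvd f i x" if i: "i \<in> I" for i
      proof -
        have "int (M i) dvd f i x - t * f i c"
          using presents_iff[OF P UNIV_I, THEN iffD1, OF L] i int_linear_diff_cmult[OF lin[OF i]]
          by metis
        moreover have "int (M i) dvd t * f i c"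
          using t M[OF i] by (meson dvd_mult2 dvd_trans of_nat_dvd_iff)
        ultimately show ?thesis by (metis diff_add_cancel dvd_add)
      qed
      then show "x \<in> \<Lambda>" using presents_iff[OF P] by simp
    qed
  qed
  then show ?thesis by blast
qed

section \<open>Quotients and products of abelian groups\<close>

lemma (in comm_group) subgroup_torsion:
  "subgroup {x \<in> carrier G. \<exists>n::nat. n > 0 \<and> x [^] n = \<one>} G"
proof
  fix x y
  assume "x \<in> {x \<in> carrier G. \<exists>n::nat. n > 0 \<and> x [^] n = \<one>}"
    and "y \<in> {x \<in> carrier G. \<exists>n::nat. n > 0 \<and> x [^] n = \<one>}"
  then obtain m n :: nat where *: "x \<in> carrier G" "y \<in> carrier G" "m > 0" "n > 0"
    "x [^] m = \<one>" "y [^] n = \<one>" by blast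
  have "x [^] (m * n) = \<one>" using *(1,5) by (simp flip: nat_pow_pow)
  moreover have "y [^] (m * n) = \<one>" using *(2,6) by (simp add: mult.commute[of m n] flip: nat_pow_pow)
  ultimately have "(x \<otimes> y) [^] (m * n) = \<one>" using * by (simp add: nat_pow_distrib)
  then show "x \<otimes> y \<in> {x \<in> carrier G. \<exists>n::nat. n > 0 \<and> x [^] n = \<one>}"
    using * by (intro CollectI conjI exI[of _ "m * n"]) auto
qed (auto simp: nat_pow_inv intro: exI[of _ 1])

lemma (in comm_group) subgroup_powers:
  "subgroup ((\<lambda>x. x [^] (n::nat)) ` carrier G) G"
proof
  fix x y
  assume "x \<in> (\<lambda>x. x [^] n) ` carrier G" "y \<in> (\<lambda>x. x [^] n) ` carrier G"
  then obtain a b where "a \<in> carrier G" "b \<in> carrier G" "x = a [^] n" "y = b [^] n" by blast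
  then show "x \<otimes> y \<in> (\<lambda>x. x [^] n) ` carrier G"
    by (intro image_eqI[of _ _ "a \<otimes> b"]) (auto simp: nat_pow_distrib)
next
  show "\<one> \<in> (\<lambda>x. x [^] n) ` carrier G"
    by (intro image_eqI[of _ _ \<one>]) auto
next
  fix x assume "x \<in> (\<lambda>x. x [^] n) ` carrier G"
  then obtain a where "a \<in> carrier G" "x = a [^] n" by blast
  then show "inv x \<in> (\<lambda>x. x [^] n) ` carrier G"
    by (intro image_eqI[of _ _ "inv a"]) (auto simp: nat_pow_inv)
qed auto

lemma (in comm_group) comm_group_restrict_subgroup:
  assumes "subgroup H G" shows "comm_group (G\<lparr>carrier := H\<rparr>)"
  by (rule group.group_comm_groupI[OF subgroup.subgroup_is_group[OF assms is_group]])
    (use subgroup.subset[OF assms] in \<open>auto intro!: m_comm\<close>)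

text \<open>By \<open>tors\<close>, \<open>Z\<close> is the full preimage of the torsion subgroup of
  \<open>G Mod S\<close>, so it maps onto that subgroup and then onto its quotient by
  \<open>q\<close>-th powers. An element of \<open>Z\<close> dies iff its coset is the
  \<open>q\<close>-th power of a torsion coset, which is why \<open>w\<close> ranges over
  \<open>Z\<close> and not over all of \<open>G\<close>.\<close>

lemma (in comm_group) quotient_torsion_epi:
  assumes S: "subgroup S G" and Z: "subgroup Z G"
    and tors: "\<And>x. x \<in> carrier G \<Longrightarrow> x \<in> Z \<longleftrightarrow> (\<exists>n::nat. n > 0 \<and> x [^] n \<in> S)"
  shows "comm_group (quotient_by_multiples (torsion_group (G Mod S)) q)"
    and "\<exists>h \<in> hom (G\<lparr>carrier := Z\<rparr>) (quotient_by_multiples (torsion_group (G Mod S)) q).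
      h ` Z = carrier (quotient_by_multiples (torsion_group (G Mod S)) q) \<and>
      kernel (G\<lparr>carrier := Z\<rparr>) (quotient_by_multiples (torsion_group (G Mod S)) q) h
        = {x \<in> Z. \<exists>s\<in>S. \<exists>w\<in>Z. x = s \<otimes> w [^] q}"
proof -
  define C where "C = G Mod S"
  interpret S: normal S G using subgroup_imp_normal[OF S] .
  interpret C: comm_group C unfolding C_def by (rule abelian_FactGroup[OF S])
  have pi: "(\<lambda>a. S #> a) \<in> hom G C" unfolding C_def by (rule S.r_coset_hom_Mod)
  interpret pi: group_hom G C "\<lambda>a. S #> a"
    using pi by unfold_locales
  have oneC: "\<one>\<^bsub>C\<^esub> = S" by (simp add: C_def FactGroup_def)
  have eqone: "S #> x = S \<longleftrightarrow> x \<in> S" if "x \<in> carrier G" for x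
    using coset_join1[OF _ that S] coset_join2[OF that S] by blast
  have eqcos: "S #> x = S #> y \<longleftrightarrow> (\<exists>s\<in>S. x = s \<otimes> y)" if "x \<in> carrier G" "y \<in> carrier G" for x y
  proof -
    have "x \<in> S #> y \<longleftrightarrow> (\<exists>s\<in>S. x = s \<otimes> y)" by (auto simp: r_coset_def)
    then show ?thesis
      using repr_independenceD[OF S that(1), of y] repr_independence[OF _ that(2) S, of x] by metis
  qed
  define K where "K = torsion_group C"
  define T where "T = {x \<in> carrier C. \<exists>n::nat. n > 0 \<and> x [^]\<^bsub>C\<^esub> n = \<one>\<^bsub>C\<^esub>}"
  have K: "K = C\<lparr>carrier := T\<rparr>" by (simp add: K_def torsion_group_def T_def)
  have subT: "subgroup T C" unfolding T_def by (rule C.subgroup_torsion)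
  interpret K: comm_group K unfolding K by (rule C.comm_group_restrict_subgroup[OF subT])
  have carC: "carrier C = (\<lambda>a. S #> a) ` carrier G"
    by (auto simp: C_def FactGroup_def RCOSETS_def)
  have "S #> x \<in> T \<longleftrightarrow> x \<in> Z" if x: "x \<in> carrier G" for x
    using x by (simp add: T_def tors[OF x] oneC eqone flip: pi.hom_nat_pow)
  then have T: "T = (\<lambda>a. S #> a) ` Z"
    using subgroup.subset[OF Z] carC by (auto simp: T_def image_iff) 
  define P where "P = (\<lambda>x. x [^]\<^bsub>K\<^esub> q) ` carrier K"
  have powK: "x [^]\<^bsub>K\<^esub> q = x [^]\<^bsub>C\<^esub> q" for x by (simp add: K flip: C.nat_pow_consistent)
  have subP: "subgroup P K" unfolding P_def by (rule K.subgroup_powers)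
  interpret P: normal P K using K.subgroup_imp_normal[OF subP] .
  have Q: "quotient_by_multiples (torsion_group (G Mod S)) q = K Mod P"
    by (simp add: quotient_by_multiples_def P_def K_def C_def)
  show "comm_group (quotient_by_multiples (torsion_group (G Mod S)) q)"
    unfolding Q by (rule K.abelian_FactGroup[OF subP])
  define h where "h = (\<lambda>x. P #>\<^bsub>K\<^esub> (S #> x))"
  have Zc: "x \<in> carrier G" if "x \<in> Z" for x using subgroup.subset[OF Z] that by blast
  have inK: "S #> x \<in> carrier K" if "x \<in> Z" for x using that by (simp add: K T)
  have "h \<in> hom (G\<lparr>carrier := Z\<rparr>) (K Mod P)"
  proof (rule homI)
    fix x y assume "x \<in> carrier (G\<lparr>carrier := Z\<rparr>)" "y \<in> carrier (G\<lparr>carrier := Z\<rparr>)"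
    then have xy: "x \<in> Z" "y \<in> Z" by auto
    have "S #> (x \<otimes> y) = (S #> x) \<otimes>\<^bsub>K\<^esub> (S #> y)"
      using pi.hom_mult[OF Zc[OF xy(1)] Zc[OF xy(2)]] by (simp add: K)
    then show "h (x \<otimes>\<^bsub>G\<lparr>carrier := Z\<rparr>\<^esub> y) = h x \<otimes>\<^bsub>K Mod P\<^esub> h y"
      using hom_mult[OF P.r_coset_hom_Mod inK[OF xy(1)] inK[OF xy(2)]] by (simp add: h_def)
  next
    fix x assume "x \<in> carrier (G\<lparr>carrier := Z\<rparr>)"
    then show "h x \<in> carrier (K Mod P)"
      using hom_in_carrier[OF P.r_coset_hom_Mod inK] by (simp add: h_def)
  qed
  moreover have "h ` Z = carrier (K Mod P)"
    by (auto simp: h_def FactGroup_def RCOSETS_def K T)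
  moreover have "kernel (G\<lparr>carrier := Z\<rparr>) (K Mod P) h = {x \<in> Z. \<exists>s\<in>S. \<exists>w\<in>Z. x = s \<otimes> w [^] q}"
  proof -
    have "carrier K = (\<lambda>a. S #> a) ` Z" by (simp add: K T)
    then have Pimg: "P = (\<lambda>w. S #> (w [^] q)) ` Z"
      unfolding P_def powK by (simp add: image_image Zc pi.hom_nat_pow cong: image_cong)
    have "h x = \<one>\<^bsub>K Mod P\<^esub> \<longleftrightarrow> (\<exists>s\<in>S. \<exists>w\<in>Z. x = s \<otimes> w [^] q)" if x: "x \<in> Z" for x
    proof -
      have "h x = \<one>\<^bsub>K Mod P\<^esub> \<longleftrightarrow> S #> x \<in> P"
        using K.coset_join1[OF _ inK[OF x] subP] K.coset_join2[OF inK[OF x] subP]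
        by (auto simp: h_def FactGroup_def)
      also have "\<dots> \<longleftrightarrow> (\<exists>w\<in>Z. S #> x = S #> (w [^] q))"
        by (auto simp: Pimg)
      also have "\<dots> \<longleftrightarrow> (\<exists>w\<in>Z. \<exists>s\<in>S. x = s \<otimes> w [^] q)"
        using eqcos Zc x by auto
      finally show ?thesis by blast
    qed
    then show ?thesis by (auto simp: kernel_def)
  qed
  ultimately show "\<exists>h \<in> hom (G\<lparr>carrier := Z\<rparr>) (quotient_by_multiples (torsion_group (G Mod S)) q).
      h ` Z = carrier (quotient_by_multiples (torsion_group (G Mod S)) q) \<and>
      kernel (G\<lparr>carrier := Z\<rparr>) (quotient_by_multiples (torsion_group (G Mod S)) q) h
        = {x \<in> Z. \<exists>s\<in>S. \<exists>w\<in>Z. x = s \<otimes> w [^] q}"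
    unfolding Q by blast
qed

text \<open>Both groups are the quotient of \<open>G\<close> by one kernel, so no map between them
  has to be constructed.\<close>

lemma iso_of_epis_same_kernel:
  assumes "group G" "group H" "group H'"
    and "h \<in> hom G H" "h ` carrier G = carrier H"
    and "h' \<in> hom G H'" "h' ` carrier G = carrier H'"
    and "kernel G H h = kernel G H' h'"
  shows "H \<cong> H'"
proof -
  interpret h: group_hom G H h using assms by (simp add: group_hom_def group_hom_axioms_def)
  interpret h': group_hom G H' h' using assms by (simp add: group_hom_def group_hom_axioms_def)
  have "group (G Mod kernel G H h)"
    by (rule normal.factorgroup_is_group[OF h.normal_kernel])
  then have "H \<cong> G Mod kernel G H h"
    by (rule group.iso_sym) (rule h.FactGroup_iso[OF assms(5)])
  moreover have "G Mod kernel G H h \<cong> H'"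
    unfolding assms(8) by (rule h'.FactGroup_iso[OF assms(7)])
  ultimately show ?thesis by (rule iso_trans)
qed

section \<open>Products of cyclic groups\<close>

lemma product_group_reindex:
  assumes h: "bij_betw h I J" and J: "\<And>j. j \<in> J \<Longrightarrow> group (A j)"
  shows "product_group J A \<cong> product_group I (\<lambda>i. A (h i))"
proof -
  have hJ: "h i \<in> J" if "i \<in> I" for i using bij_betwE[OF h] that by blast
  define k where "k = inv_into I h"
  have k: "k j \<in> I" "h (k j) = j" if "j \<in> J" for j
    using that h by (auto simp: k_def bij_betw_def f_inv_into_f inv_into_into)
  have kh: "k (h i) = i" if "i \<in> I" for i
    using that h by (simp add: k_def bij_betw_def)
  have "(\<lambda>x. \<lambda>i\<in>I. x (h i)) \<in> iso (product_group J A) (product_group I (\<lambda>i. A (h i)))"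
  proof (rule isoI)
    show "(\<lambda>x. \<lambda>i\<in>I. x (h i)) \<in> hom (product_group J A) (product_group I (\<lambda>i. A (h i)))"
      by (rule homI) (auto simp: fun_eq_iff PiE_iff hJ)
    show "bij_betw (\<lambda>x. \<lambda>i\<in>I. x (h i)) (carrier (product_group J A))
        (carrier (product_group I (\<lambda>i. A (h i))))"
    proof (rule bij_betwI[where g = "\<lambda>y. \<lambda>j\<in>J. y (k j)"])
      show "(\<lambda>y. \<lambda>j\<in>J. y (k j)) \<in> carrier (product_group I (\<lambda>i. A (h i))) \<rightarrow> carrier (product_group J A)"
        using k by (fastforce simp: PiE_iff)
    qed (auto simp: PiE_iff hJ k kh fun_eq_iff extensional_def)
  qed
  then show ?thesis by (auto simp: is_iso_def)
qed

lemma product_group_Un: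
  assumes disj: "I \<inter> J = {}" and A: "\<And>i. i \<in> I \<union> J \<Longrightarrow> group (A i)"
  shows "product_group (I \<union> J) A \<cong> product_group I A \<times>\<times> product_group J A"
proof -
  have "(\<lambda>x. (restrict x I, restrict x J)) \<in> iso (product_group (I \<union> J) A)
      (product_group I A \<times>\<times> product_group J A)"
  proof (rule isoI)
    show "(\<lambda>x. (restrict x I, restrict x J)) \<in> hom (product_group (I \<union> J) A)
        (product_group I A \<times>\<times> product_group J A)"
      by (rule homI) (auto simp: fun_eq_iff PiE_iff DirProd_def)
    show "bij_betw (\<lambda>x. (restrict x I, restrict x J)) (carrier (product_group (I \<union> J) A))
        (carrier (product_group I A \<times>\<times> product_group J A))"
      by (rule bij_betwI[where g = "\<lambda>(y, z). \<lambda>i\<in>I \<union> J. if i \<in> I then y i else z i"])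
        (use disj in \<open>auto simp: PiE_iff fun_eq_iff extensional_def DirProd_def\<close>)
  qed
  then show ?thesis by (auto simp: is_iso_def)
qed

lemma product_group_singleton:
  assumes "group (A i)" shows "product_group {i} A \<cong> A i"
proof -
  have "(\<lambda>x. x i) \<in> iso (product_group {i} A) (A i)"
  proof (rule isoI)
    show "(\<lambda>x. x i) \<in> hom (product_group {i} A) (A i)"
      by (rule homI) (auto simp: PiE_iff)
    show "bij_betw (\<lambda>x. x i) (carrier (product_group {i} A)) (carrier (A i))"
      by (rule bij_betwI[where g = "\<lambda>y. \<lambda>j\<in>{i}. y"])
        (auto simp: PiE_iff fun_eq_iff extensional_def)
  qed
  then show ?thesis by (auto simp: is_iso_def)
qed

lemma product_group_eq_cyclic_power:
  assumes "finite J" "\<And>j. j \<in> J \<Longrightarrow> M j = n"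
  shows "product_group J (\<lambda>j. integer_mod_group (M j)) \<cong> cyclic_power n (card J)"
proof -
  obtain h where h: "bij_betw h {..<card J} J"
    using bij_betw_from_nat_into_finite[OF assms(1)] by blast
  have "product_group {..<card J} (\<lambda>i. integer_mod_group (M (h i))) = cyclic_power n (card J)"
    unfolding cyclic_power_def product_group_def using assms(2) bij_betwE[OF h]
    by (auto simp: fun_eq_iff PiE_iff)
  then show ?thesis using product_group_reindex[OF h, of "\<lambda>j. integer_mod_group (M j)"] by simp
qed

lemma product_group_cyclic_split:
  assumes "finite J" "J \<inter> J' = {}" "\<And>j. j \<in> J \<Longrightarrow> M j = n"
    and "product_group J' (\<lambda>j. integer_mod_group (M j)) \<cong> D"
  shows "product_group (J \<union> J') (\<lambda>j. integer_mod_group (M j)) \<cong> cyclic_power n (card J) \<times>\<times> D"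
proof (rule iso_trans[OF product_group_Un group.DirProd_iso_trans])
  show "product_group J (\<lambda>j. integer_mod_group (M j)) \<cong> cyclic_power n (card J)"
    using assms by (intro product_group_eq_cyclic_power)
qed (use assms in simp_all)

section \<open>The cokernel of a graph Laplacian\<close>

text \<open>Gaussian elimination without division, by induction on the equations: one equation with
  a nonzero coefficient removes one unknown.\<close>

lemma int_homogeneous_system_nontrivial:
  fixes a :: "'j \<Rightarrow> 'i \<Rightarrow> int"
  assumes "finite J" "finite I" "card J < card I"
  shows "\<exists>b. (\<exists>i\<in>I. b i \<noteq> 0) \<and> (\<forall>j\<in>J. (\<Sum>i\<in>I. a j i * b i) = 0)"
  using assms
proof (induction J arbitrary: I a rule: finite_induct)
  case empty
  then obtain i where "i \<in> I" by fastforce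
  then show ?case by (intro exI[of _ "\<lambda>_. 1"]) auto
next
  case (insert j0 J)
  show ?case
  proof (cases "\<forall>i\<in>I. a j0 i = 0")
    case True
    obtain b where "\<exists>i\<in>I. b i \<noteq> 0" "\<forall>j\<in>J. (\<Sum>i\<in>I. a j i * b i) = 0"
      using insert.IH[of I a] insert.prems insert.hyps by auto
    then show ?thesis using True by (intro exI[of _ b]) auto
  next
    case False
    then obtain i0 where i0: "i0 \<in> I" "a j0 i0 \<noteq> 0" by blast
    \<comment> \<open>Cross-multiplying with the pivot \<open>a j0 i0\<close> eliminates the unknown
      \<open>i0\<close> and stays in the integers; equation \<open>j0\<close> itself becomes
      zero.\<close>
    define a' where "a' = (\<lambda>j i. a j0 i0 * a j i - a j i0 * a j0 i)"
    have "card J < card (I - {i0})" using insert.prems insert.hyps i0 by simp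
    then obtain b' where b': "\<exists>i\<in>I - {i0}. b' i \<noteq> 0"
      "\<And>j. j \<in> J \<Longrightarrow> (\<Sum>i\<in>I - {i0}. a' j i * b' i) = 0"
      using insert.IH[of "I - {i0}" a'] insert.prems by auto
    \<comment> \<open>Back substitution, scaled by the pivot so that \<open>b i0\<close> is
      integral.\<close>
    define b where "b = (\<lambda>i. if i = i0 then - (\<Sum>i\<in>I - {i0}. a j0 i * b' i) else a j0 i0 * b' i)"
    have sum_b: "(\<Sum>i\<in>I. a j i * b i) = (\<Sum>i\<in>I - {i0}. a' j i * b' i)" for j
    proof -
      have "(\<Sum>i\<in>I. a j i * b i) = a j i0 * b i0 + (\<Sum>i\<in>I - {i0}. a j i * b i)"
        using insert.prems i0 by (simp add: sum.remove)
      also have "(\<Sum>i\<in>I - {i0}. a j i * b i) = (\<Sum>i\<in>I - {i0}. a j0 i0 * a j i * b' i)"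
        by (rule sum.cong) (auto simp: b_def algebra_simps)
      also have "a j i0 * b i0 = - (\<Sum>i\<in>I - {i0}. a j i0 * a j0 i * b' i)"
        by (simp add: b_def sum_distrib_left algebra_simps)
      finally show ?thesis by (simp add: a'_def left_diff_distrib sum_subtractf)
    qed
    have "a' j0 = (\<lambda>_. 0)" by (simp add: a'_def fun_eq_iff)
    then have "\<forall>j\<in>insert j0 J. (\<Sum>i\<in>I. a j i * b i) = 0" using b'(2) by (simp add: sum_b)
    moreover have "\<exists>i\<in>I. b i \<noteq> 0" using b'(1) i0 by (auto simp: b_def)
    ultimately show ?thesis by blast
  qed
qed

section \<open>The Laplacian in coordinates\<close>

definition frag_of_fun :: "'v set \<Rightarrow> ('v \<Rightarrow> int) \<Rightarrow> ('v \<Rightarrow>\<^sub>0 int)" where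
  "frag_of_fun V b = (\<Sum>v\<in>V. frag_cmul (b v) (frag_of v))"

lemma lookup_frag_of_fun:
  "finite V \<Longrightarrow> Poly_Mapping.lookup (frag_of_fun V b) v = (if v \<in> V then b v else 0)"
  by (simp add: frag_of_fun_def lookup_sum lookup_frag_of if_distrib cong: if_cong)

lemma keys_frag_of_fun: "finite V \<Longrightarrow> Poly_Mapping.keys (frag_of_fun V b) \<subseteq> V"
  by (metis in_keys_iff lookup_frag_of_fun subsetI)

definition laplace_fun :: "'v sgraph \<Rightarrow> ('v \<Rightarrow> int) \<Rightarrow> 'v \<Rightarrow> int" where
  "laplace_fun H y v = (\<Sum>w | {v, w} \<in> edges H. y v - y w)"

context
  fixes H :: "'v sgraph"
  assumes H: "simple_graph H"
begin

lemma finite_vertices: "finite (vertices H)"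
  using H by (simp add: simple_graph_def)

lemma edge_vertices: "{v, w} \<in> edges H \<Longrightarrow> v \<in> vertices H \<and> w \<in> vertices H \<and> v \<noteq> w"
  using H by (force simp: simple_graph_def)

lemma finite_neighbours: "finite {w. {v, w} \<in> edges H}"
  by (rule finite_subset[OF _ finite_vertices]) (use edge_vertices in blast)

lemma laplacian_diff: "laplacian H (x - y) = laplacian H x - laplacian H y"
  by (simp add: laplacian_def frag_extend_diff)

lemma laplacian_of: "laplacian H (frag_of a) = (\<Sum>w | {a, w} \<in> edges H. frag_of a - frag_of w)"
  by (simp add: laplacian_def)

text \<open>\<open>laplacian\<close> is given on generators, that is by columns, and
  \<open>laplace_fun\<close> by rows; they agree because adjacency is symmetric.\<close>

lemma lookup_laplacian:
  "Poly_Mapping.lookup (laplacian H x) v = laplace_fun H (Poly_Mapping.lookup x) v"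
proof (induction x rule: free_Abelian_group_induct[where S = UNIV, OF subset_UNIV])
  case 1
  then show ?case by (simp add: laplacian_def laplace_fun_def)
next
  case (2 x y)
  then show ?case
    by (simp add: laplacian_diff laplace_fun_def lookup_minus flip: sum_subtractf)
       (rule sum.cong, auto)
next
  case (3 a)
  have sw: "(\<Sum>w | {u, w} \<in> edges H. of_bool (w = z)) = (of_bool ({u, z} \<in> edges H) :: int)" for u z
    using finite_neighbours[of u] by (simp add: of_bool_def sum.If_cases)
  have "Poly_Mapping.lookup (laplacian H (frag_of a)) v
      = (\<Sum>w | {a, w} \<in> edges H. of_bool (v = a) - of_bool (w = v))"
    unfolding laplacian_of lookup_sum by (rule sum.cong) (auto simp: lookup_minus lookup_frag_of)
  also have "\<dots> = (\<Sum>w | {v, w} \<in> edges H. of_bool (v = a) - of_bool (w = a))"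
    by (cases "v = a") (simp_all add: sum_subtractf sum_negf sw insert_commute[of a v])
  also have "\<dots> = laplace_fun H (Poly_Mapping.lookup (frag_of a)) v"
    unfolding laplace_fun_def by (rule sum.cong) (auto simp: lookup_frag_of)
  finally show ?case .
qed

lemma keys_laplacian: "Poly_Mapping.keys (laplacian H x) \<subseteq> vertices H"
proof
  fix v assume "v \<in> Poly_Mapping.keys (laplacian H x)"
  then have "laplace_fun H (Poly_Mapping.lookup x) v \<noteq> 0"
    by (simp add: in_keys_iff lookup_laplacian)
  then obtain w where "{v, w} \<in> edges H"
    unfolding laplace_fun_def
    by (metis (mono_tags) mem_Collect_eq sum.not_neutral_contains_not_neutral)
  then show "v \<in> vertices H" using edge_vertices by blast
qed

text \<open>Each edge occurs in both orientations with opposite contributions. Thus the image of the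
  Laplacian consists of vectors of degree zero.\<close>

lemma sum_laplace_fun: "(\<Sum>v\<in>vertices H. laplace_fun H y v) = 0"
proof -
  let ?P = "{(v, w). {v, w} \<in> edges H}"
  have fin: "finite ?P"
    by (rule finite_subset[of _ "vertices H \<times> vertices H"])
      (use edge_vertices finite_vertices in auto)
  have P: "?P = Sigma (vertices H) (\<lambda>v. {w. {v, w} \<in> edges H})" using edge_vertices by auto
  have "(\<Sum>v\<in>vertices H. laplace_fun H y v) = (\<Sum>(v, w)\<in>?P. y v - y w)"
    unfolding laplace_fun_def P by (rule sum.Sigma) (auto simp: finite_vertices finite_neighbours)
  also have "\<dots> = (\<Sum>(v, w)\<in>?P. y v) - (\<Sum>(v, w)\<in>?P. y w)"
    by (simp add: sum_subtractf case_prod_unfold)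
  also have "(\<Sum>(v, w)\<in>?P. y w) = (\<Sum>(v, w)\<in>?P. y v)"
    by (rule sum.reindex_bij_witness[of _ prod.swap prod.swap]) (auto simp: insert_commute)
  finally show ?thesis by simp
qed

lemma laplace_fun_linear:
  "laplace_fun H (\<lambda>v. a * x v + b * y v) v = a * laplace_fun H x v + b * laplace_fun H y v"
  unfolding laplace_fun_def sum_distrib_left sum.distrib[symmetric]
  by (rule sum.cong) (auto simp: algebra_simps)

lemma laplace_fun_cong:
  assumes "\<And>u. u \<in> vertices H \<Longrightarrow> x u = y u" "v \<in> vertices H"
  shows "laplace_fun H x v = laplace_fun H y v"
  unfolding laplace_fun_def by (rule sum.cong) (use assms edge_vertices in auto)

text \<open>Maximum principle: where \<open>y\<close> is maximal, the differences to the neighbours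
  are nonnegative and sum to zero, so the maximum spreads along walks.\<close>

lemma harmonic_constant:
  assumes conn: "connected_graph H" and y: "\<And>v. v \<in> vertices H \<Longrightarrow> laplace_fun H y v = 0"
    and uv: "u \<in> vertices H" "v \<in> vertices H"
  shows "y u = y v"
proof -
  define m where "m = Max (y ` vertices H)"
  have le: "y w \<le> m" if "w \<in> vertices H" for w
    using that finite_vertices by (simp add: m_def)
  have "m \<in> y ` vertices H" unfolding m_def using finite_vertices uv by (intro Max_in) auto
  then obtain z where z: "z \<in> vertices H" "y z = m" by blast
  have "w \<in> vertices H \<longrightarrow> y w = m" if "(z, w) \<in> {(x, y). {x, y} \<in> edges H}\<^sup>*" for w
    using that
  proof (induction rule: rtrancl_induct)
    case (step w w')
    then have e: "{w, w'} \<in> edges H" by simp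
    then have w: "w \<in> vertices H" "w' \<in> vertices H" "y w = m" using step edge_vertices by auto
    have "(\<Sum>w'' | {w, w''} \<in> edges H. y w - y w'') = 0"
      using y[OF w(1)] by (simp add: laplace_fun_def)
    then have "\<forall>w''\<in>{w''. {w, w''} \<in> edges H}. y w - y w'' = 0"
      by (subst (asm) sum_nonneg_eq_0_iff) (use finite_neighbours le edge_vertices w in auto)
    then show ?case using e w by auto
  qed (use z in simp)
  then show ?thesis using conn uv z unfolding connected_graph_def by metis
qed

text \<open>A count of equations and unknowns yields a nontrivial integral relation between
  \<open>x\<close> and columns of the Laplacian. It must involve \<open>x\<close>, because otherwise
  it would be a nonzero harmonic function vanishing at \<open>r\<close>.\<close>

lemma degree_zero_torsion:
  assumes conn: "connected_graph H" and x: "(\<Sum>v\<in>vertices H. x v) = 0"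
  shows "\<exists>(n::nat) y. n > 0 \<and> (\<forall>v\<in>vertices H. laplace_fun H y v = int n * x v)"
proof -
  obtain r where r: "r \<in> vertices H" using conn by (auto simp: connected_graph_def)
  let ?V = "vertices H"
  \<comment> \<open>One equation per vertex except \<open>r\<close>, where it follows from the others by summation; the
    column of \<open>r\<close>, which is redundant among those of the Laplacian, is replaced by \<open>x\<close>.\<close>
  define a where "a = (\<lambda>j i. if i = r then x j else laplace_fun H (\<lambda>u. of_bool (u = i)) j)"
  have "card (?V - {r}) < card ?V" using finite_vertices r by (rule card_Diff1_less)
  then obtain b where b: "\<exists>i\<in>?V. b i \<noteq> 0"
    "\<And>j. j \<in> ?V - {r} \<Longrightarrow> (\<Sum>i\<in>?V. a j i * b i) = 0"
    using int_homogeneous_system_nontrivial[of "?V - {r}" ?V a] finite_vertices by auto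
  \<comment> \<open>\<open>b r\<close> serves as the coefficient of \<open>x\<close>, so the
    potential itself gets the value 0 at \<open>r\<close>.\<close>
  define y where "y = (\<lambda>i. if i = r then 0 else b i)"
  have lap: "laplace_fun H y j = (\<Sum>i\<in>?V. laplace_fun H (\<lambda>u. of_bool (u = i)) j * y i)"
    if "j \<in> ?V" for j
  proof -
    have "laplace_fun H y j = laplace_fun H (\<lambda>u. \<Sum>i\<in>?V. of_bool (u = i) * y i) j"
    proof (rule laplace_fun_cong)
      fix u assume u: "u \<in> ?V"
      then have "?V \<inter> {i. u = i} = {u}" by auto
      then show "y u = (\<Sum>i\<in>?V. of_bool (u = i) * y i)"
        using finite_vertices by (simp add: sum_of_bool_mult_eq)
    qed (rule that)
    also have "\<dots> = (\<Sum>i\<in>?V. laplace_fun H (\<lambda>u. of_bool (u = i)) j * y i)"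
      unfolding laplace_fun_def sum_distrib_right
      by (subst sum.swap) (simp add: sum_subtractf left_diff_distrib)
    finally show ?thesis .
  qed
  have eq: "(\<Sum>i\<in>?V. a j i * b i) = b r * x j + laplace_fun H y j" if "j \<in> ?V" for j
  proof -
    have "(\<Sum>i\<in>?V. a j i * b i) = a j r * b r + (\<Sum>i\<in>?V - {r}. a j i * b i)"
      using finite_vertices r by (simp add: sum.remove)
    also have "(\<Sum>i\<in>?V - {r}. a j i * b i) =
        (\<Sum>i\<in>?V - {r}. laplace_fun H (\<lambda>u. of_bool (u = i)) j * y i)"
      by (rule sum.cong) (auto simp: a_def y_def)
    also have "\<dots> = (\<Sum>i\<in>?V. laplace_fun H (\<lambda>u. of_bool (u = i)) j * y i)"
      by (rule sum.mono_neutral_left) (use finite_vertices in \<open>auto simp: y_def\<close>)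
    finally show ?thesis by (simp add: lap[OF that] a_def)
  qed
  have off_r: "b r * x j + laplace_fun H y j = 0" if "j \<in> ?V - {r}" for j
    using b(2)[OF that] eq that by simp
  have "(\<Sum>j\<in>?V. b r * x j + laplace_fun H y j) = 0"
    using x by (simp add: sum.distrib sum_laplace_fun flip: sum_distrib_left)
  then have all: "b r * x j + laplace_fun H y j = 0" if "j \<in> ?V" for j
    using off_r that finite_vertices r by (cases "j = r") (auto simp: sum.remove)
  have br: "b r \<noteq> 0"
  proof
    assume "b r = 0"
    then have "y i = y r" if "i \<in> ?V" for i
      using harmonic_constant[OF conn _ that r] all by simp
    then have "b i = 0" if "i \<in> ?V" for i using that \<open>b r = 0\<close> by (metis y_def)
    then show False using b(1) by blast
  qed
  have "laplace_fun H (\<lambda>v. - sgn (b r) * y v) j = int (nat \<bar>b r\<bar>) * x j" if "j \<in> ?V" for j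
  proof -
    have "laplace_fun H (\<lambda>v. - sgn (b r) * y v) j = - sgn (b r) * laplace_fun H y j"
      using laplace_fun_linear[of "- sgn (b r)" y 0 y j] by simp
    also have "\<dots> = sgn (b r) * b r * x j" using all[OF that] by (simp add: add_eq_0_iff)
    also have "sgn (b r) * b r = int (nat \<bar>b r\<bar>)" by (simp add: sgn_if)
    finally show ?thesis .
  qed
  then show ?thesis using br by 
    (intro exI[of _ "nat \<bar>b r\<bar>"] exI[of _ "\<lambda>v. - sgn (b r) * y v"]) simp
qed

text \<open>The group \<open>Z\<close> of degree zero vectors maps onto both sides: to the critical
  group modulo \<open>q\<close> by cosets, and to the product by the functionals \<open>g j\<close>
  modulo \<open>M j\<close>. Both kernels are \<open>Z\<close> intersected with the lattice of
  \<open>P\<close>.\<close>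

lemma quotient_critical_group_iso:
  assumes conn: "connected_graph H" and q: "q > 0"
    and P: "presents {x. (\<Sum>v\<in>vertices H. x v) = 0}
      {x. \<exists>y w. \<forall>v\<in>vertices H. x v = laplace_fun H y v + int q * w v} J M g"
    and M: "\<And>j. j \<in> J \<Longrightarrow> M j > 0"
  shows "quotient_by_multiples (critical_group H) q \<cong> product_group J (\<lambda>j. integer_mod_group (M j))"
proof -
  let ?V = "vertices H" and ?F = "free_Abelian_group (vertices H)"
  let ?S = "laplacian H ` carrier ?F"
  let ?lk = "Poly_Mapping.lookup"
  let ?\<Lambda> = "{x. \<exists>y w. \<forall>v\<in>?V. x v = laplace_fun H y v + int q * w v}"
  define Z where "Z = {x :: 'v \<Rightarrow>\<^sub>0 int. Poly_Mapping.keys x \<subseteq> ?V \<and> (\<Sum>v\<in>?V. ?lk x v) = 0}"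
  interpret F: comm_group ?F by (rule abelian_free_Abelian_group)
  have carF: "carrier ?F = {x. Poly_Mapping.keys x \<subseteq> ?V}" by auto
  have frag_eq: "x = y" if "Poly_Mapping.keys x \<subseteq> ?V" "Poly_Mapping.keys y \<subseteq> ?V"
    "\<And>v. v \<in> ?V \<Longrightarrow> ?lk x v = ?lk y v" for x y :: "'v \<Rightarrow>\<^sub>0 int"
    by (rule poly_mapping_eqI) (use that in \<open>metis in_keys_iff subsetD\<close>)
  have lap_ff: "laplace_fun H (?lk (frag_of_fun ?V y)) v = laplace_fun H y v" if "v \<in> ?V" for y v
    by (rule laplace_fun_cong) (use that finite_vertices in \<open>auto simp: lookup_frag_of_fun\<close>)
  have subS: "subgroup ?S ?F"
  proof
    show "?S \<subseteq> carrier ?F" using keys_laplacian by auto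
    show "\<one>\<^bsub>?F\<^esub> \<in> ?S" by (rule image_eqI[of _ _ 0]) (auto simp: laplacian_def)
  next
    fix x y assume "x \<in> ?S" "y \<in> ?S"
    then obtain a b where "Poly_Mapping.keys a \<subseteq> ?V" "Poly_Mapping.keys b \<subseteq> ?V"
      "x = laplacian H a" "y = laplacian H b" by auto
    then show "x \<otimes>\<^bsub>?F\<^esub> y \<in> ?S"
      using keys_add[of a b] by (intro image_eqI[of _ _ "a + b"]) (auto simp: laplacian_def frag_extend_add)
  next
    fix x assume "x \<in> ?S"
    then obtain a where "Poly_Mapping.keys a \<subseteq> ?V" "x = laplacian H a" by auto
    then show "inv\<^bsub>?F\<^esub> x \<in> ?S"
      using keys_laplacian[of a] by (intro image_eqI[of _ _ "- a"]) (auto simp: laplacian_def frag_extend_minus)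
  qed
  have subZ: "subgroup Z ?F"
  proof
    fix x y assume "x \<in> Z" "y \<in> Z"
    then show "x \<otimes>\<^bsub>?F\<^esub> y \<in> Z"
      using keys_add[of x y] by (auto simp: Z_def lookup_add sum.distrib)
  next
    fix x assume "x \<in> Z"
    then show "inv\<^bsub>?F\<^esub> x \<in> Z" by (auto simp: Z_def sum_negf)
  qed (auto simp: Z_def)
  \<comment> \<open>Degree zero is the same as being torsion modulo the image of the Laplacian: one
    direction is \<open>degree_zero_torsion\<close>, the other holds because that image has degree
    zero.\<close>
  have "x \<in> Z \<longleftrightarrow> (\<exists>n::nat. n > 0 \<and> x [^]\<^bsub>?F\<^esub> n \<in> ?S)" if "x \<in> carrier ?F" for x
  proof
    assume "x \<in> Z"
    then obtain n y where n: "n > 0" "\<And>v. v \<in> ?V \<Longrightarrow> laplace_fun H y v = int n * ?lk x v"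
      using degree_zero_torsion[OF conn, of "?lk x"] by (auto simp: Z_def)
    have "laplacian H (frag_of_fun ?V y) = frag_cmul (int n) x"
      by (rule frag_eq) (use keys_laplacian that keys_cmul n lap_ff in
          \<open>auto simp: lookup_laplacian\<close>)
    moreover have "frag_of_fun ?V y \<in> carrier ?F" using keys_frag_of_fun[OF finite_vertices] by simp
    ultimately have "frag_cmul (int n) x \<in> ?S" by (metis imageI)
    then show "\<exists>n::nat. n > 0 \<and> x [^]\<^bsub>?F\<^esub> n \<in> ?S" using n(1) by auto
  next
    assume "\<exists>n::nat. n > 0 \<and> x [^]\<^bsub>?F\<^esub> n \<in> ?S"
    then obtain n :: nat and y where n: "n > 0" "frag_cmul (int n) x = laplacian H y" by auto
    have "int n * (\<Sum>v\<in>?V. ?lk x v) = (\<Sum>v\<in>?V. ?lk (frag_cmul (int n) x) v)"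
      by (simp add: sum_distrib_left)
    also have "\<dots> = 0" unfolding n(2) lookup_laplacian by (rule sum_laplace_fun)
    finally show "x \<in> Z" using n(1) that by (simp add: Z_def)
  qed
  note epi = F.quotient_torsion_epi[OF subS subZ this, of q, folded laplacian_cokernel_def,
      folded critical_group_def]
  let ?Q = "quotient_by_multiples (critical_group H) q"
  let ?P = "product_group J (\<lambda>j. integer_mod_group (M j))"
  obtain h where h: "h \<in> hom (?F\<lparr>carrier := Z\<rparr>) ?Q" "h ` Z = carrier ?Q"
    "kernel (?F\<lparr>carrier := Z\<rparr>) ?Q h = {x \<in> Z. \<exists>s\<in>?S. \<exists>w\<in>Z. x = s \<otimes>\<^bsub>?F\<^esub> w [^]\<^bsub>?F\<^esub> q}"
    using epi(2) by blast
  have grp: "group (?F\<lparr>carrier := Z\<rparr>)" by (rule subgroup.subgroup_is_group[OF subZ F.is_group])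
  have kerQ: "(\<exists>s\<in>?S. \<exists>w\<in>Z. x = s \<otimes>\<^bsub>?F\<^esub> w [^]\<^bsub>?F\<^esub> q) \<longleftrightarrow> ?lk x \<in> ?\<Lambda>" if "x \<in> Z" for x
  proof
    assume "\<exists>s\<in>?S. \<exists>w\<in>Z. x = s \<otimes>\<^bsub>?F\<^esub> w [^]\<^bsub>?F\<^esub> q"
    then obtain y w where "x = laplacian H y + frag_cmul (int q) w"
      unfolding mult_free_Abelian_group pow_free_Abelian_group by blast
    then have "\<forall>v\<in>?V. ?lk x v = laplace_fun H (?lk y) v + int q * ?lk w v"
      by (simp add: lookup_add lookup_laplacian)
    then show "?lk x \<in> ?\<Lambda>" by blast
  next
    assume "?lk x \<in> ?\<Lambda>"
    then obtain y w where yw: "\<And>v. v \<in> ?V \<Longrightarrow> ?lk x v = laplace_fun H y v + int q * w v" by blast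
    \<comment> \<open>The lattice allows any \<open>w\<close>, the kernel only a \<open>w\<close> of
      degree zero. As \<open>x\<close> and the Laplacian part have degree zero and
      \<open>q > 0\<close>, this is automatic.\<close>
    have "(\<Sum>v\<in>?V. ?lk x v) = (\<Sum>v\<in>?V. laplace_fun H y v) + int q * (\<Sum>v\<in>?V. w v)"
      unfolding sum_distrib_left sum.distrib[symmetric] by (rule sum.cong) (auto simp: yw)
    then have "(\<Sum>v\<in>?V. w v) = 0" using that q sum_laplace_fun by (simp add: Z_def)
    then have "frag_of_fun ?V w \<in> Z"
      using keys_frag_of_fun[OF finite_vertices] by (simp add: Z_def lookup_frag_of_fun finite_vertices)
    moreover have "laplacian H (frag_of_fun ?V y) \<in> ?S"
      using keys_frag_of_fun[OF finite_vertices] by (intro imageI) simp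
    moreover have "x = laplacian H (frag_of_fun ?V y) + frag_cmul (int q) (frag_of_fun ?V w)"
    proof (rule frag_eq)
      show "Poly_Mapping.keys x \<subseteq> ?V" using that by (simp add: Z_def)
      show "Poly_Mapping.keys (laplacian H (frag_of_fun ?V y) + frag_cmul (int q) (frag_of_fun ?V w)) \<subseteq> ?V"
        by (rule order_trans[OF keys_add Un_least[OF keys_laplacian
              order_trans[OF keys_cmul keys_frag_of_fun[OF finite_vertices]]]])
    qed (auto simp: lookup_add lookup_laplacian lap_ff yw lookup_frag_of_fun finite_vertices)
    ultimately show "\<exists>s\<in>?S. \<exists>w\<in>Z. x = s \<otimes>\<^bsub>?F\<^esub> w [^]\<^bsub>?F\<^esub> q"
      unfolding mult_free_Abelian_group pow_free_Abelian_group by blast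
  qed
  define h' where "h' = (\<lambda>x. \<lambda>j\<in>J. g j (?lk x) mod int (M j))"
  have lk_add: "?lk (x + y) = (\<lambda>e. ?lk x e + ?lk y e)" for x y :: "'v \<Rightarrow>\<^sub>0 int"
    by (simp add: fun_eq_iff lookup_add)
  have car_mod: "carrier (integer_mod_group (M j)) = {0..<int (M j)}" if "j \<in> J" for j
    using M[OF that] by (simp add: carrier_integer_mod_group)
  have h'_hom: "h' \<in> hom (?F\<lparr>carrier := Z\<rparr>) ?P"
  proof (rule homI)
    fix x assume "x \<in> carrier (?F\<lparr>carrier := Z\<rparr>)"
    then show "h' x \<in> carrier ?P" using M by (auto simp: h'_def car_mod)
  next
    fix x y assume "x \<in> carrier (?F\<lparr>carrier := Z\<rparr>)" "y \<in> carrier (?F\<lparr>carrier := Z\<rparr>)"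
    then show "h' (x \<otimes>\<^bsub>?F\<lparr>carrier := Z\<rparr>\<^esub> y) = h' x \<otimes>\<^bsub>?P\<^esub> h' y"
      by (auto simp: h'_def fun_eq_iff lk_add int_linear_add[OF presents_linear[OF P]] mod_add_eq)
  qed
  have h'_onto: "h' ` Z = carrier ?P"
  proof
    show "h' ` Z \<subseteq> carrier ?P" using h'_hom by (auto simp: hom_def)
    show "carrier ?P \<subseteq> h' ` Z"
    proof
      fix t assume t: "t \<in> carrier ?P"
      obtain x where x: "(\<Sum>v\<in>?V. x v) = 0" "\<And>j. j \<in> J \<Longrightarrow> int (M j) dvd g j x - t j"
        using presents_surj[OF P, of t] by auto
      define x' where "x' = frag_of_fun ?V x"
      have x'Z: "x' \<in> Z"
        using x(1) keys_frag_of_fun[OF finite_vertices]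
        by (simp add: Z_def x'_def lookup_frag_of_fun finite_vertices)
      have "h' x' = t"
      proof
        fix j
        show "h' x' j = t j"
        proof (cases "j \<in> J")
          case j: True
          \<comment> \<open>\<open>g j\<close> is a functional on all functions, so cutting
            \<open>x\<close> down to the vertices might change its value. The difference vanishes on
            the vertices, hence lies in the lattice, and \<open>g j\<close> is zero on it modulo
            \<open>M j\<close>.\<close>
          let ?d = "\<lambda>v. ?lk x' v - 1 * x v"
          have d0: "?d v = 0" if "v \<in> ?V" for v
            using that by (simp add: x'_def lookup_frag_of_fun finite_vertices)
          then have "?d \<in> ?\<Lambda>"
            by (intro CollectI exI[of _ "\<lambda>_. 0"]) (auto simp: laplace_fun_def)
          moreover have "?d \<in> {x. (\<Sum>v\<in>?V. x v) = 0}" using d0 by simp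
          ultimately have "int (M j) dvd g j ?d" using presents_iff[OF P] j by blast
          then have "int (M j) dvd g j (?lk x') - g j x"
            unfolding int_linear_diff_cmult[OF presents_linear[OF P j]] by simp
          then have "int (M j) dvd g j (?lk x') - t j" using x(2)[OF j] dvd_add by fastforce
          moreover have "t j \<in> {0..<int (M j)}" using t j car_mod by (auto simp: PiE_iff)
          ultimately show ?thesis using j by (simp add: h'_def mod_eq_dvd_iff[symmetric])
        next
          case False
          then show ?thesis using t by (simp add: h'_def PiE_iff extensional_def)
        qed
      qed
      then show "t \<in> h' ` Z" using x'Z by blast
    qed
  qed
  have "kernel (?F\<lparr>carrier := Z\<rparr>) ?P h' = {x \<in> Z. ?lk x \<in> ?\<Lambda>}"
  proof -
    have "h' x = \<one>\<^bsub>?P\<^esub> \<longleftrightarrow> ?lk x \<in> ?\<Lambda>" if "x \<in> Z" for x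
    proof -
      have "?lk x \<in> {x. (\<Sum>v\<in>?V. x v) = 0}" using that by (simp add: Z_def)
      from presents_iff[OF P this] show ?thesis
        by (auto simp: h'_def fun_eq_iff restrict_def dvd_eq_mod_eq_0)
    qed
    then show ?thesis by (auto simp: kernel_def)
  qed
  then have "kernel (?F\<lparr>carrier := Z\<rparr>) ?Q h = kernel (?F\<lparr>carrier := Z\<rparr>) ?P h'"
    unfolding h(3) using kerQ by blast
  then show ?thesis
    using iso_of_epis_same_kernel[OF grp _ _ h(1) _ h'_hom] h(2) h'_onto epi(1)
    by (simp add: comm_group.axioms(2))
qed

end

section \<open>Incidence maps and spanning trees\<close>

text \<open>\<open>vertex_sum E\<close> is the incidence map \<open>N\<close>, and \<open>edge_sum\<close> is its transpose.\<close>

definition vertex_sum :: "'a set set \<Rightarrow> ('a set \<Rightarrow> 'b::comm_monoid_add) \<Rightarrow> 'a \<Rightarrow> 'b" where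
  "vertex_sum E z v = (\<Sum>e | e \<in> E \<and> v \<in> e. z e)"

definition edge_sum :: "('a \<Rightarrow> 'b::comm_monoid_add) \<Rightarrow> 'a set \<Rightarrow> 'b" where
  "edge_sum y e = (\<Sum>v\<in>e. y v)"

lemma edge_sum_pair [simp]: "v \<noteq> w \<Longrightarrow> edge_sum y {v, w} = y v + y w"
  by (simp add: edge_sum_def)

lemma edge_sum_cong: "(\<And>v. v \<in> e \<Longrightarrow> x v = y v) \<Longrightarrow> edge_sum x e = edge_sum y e"
  unfolding edge_sum_def by (rule sum.cong) auto

lemma edge_sum_linear:
  fixes a b :: int
  shows "edge_sum (\<lambda>v. a * x v + b * y v) e = a * edge_sum x e + b * edge_sum y e"
  by (simp add: edge_sum_def sum.distrib sum_distrib_left)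

lemma edge_sum_add_cmult:
  fixes b :: int
  shows "edge_sum (\<lambda>v. x v + b * y v) e = edge_sum x e + b * edge_sum y e"
  by (simp add: edge_sum_def sum.distrib sum_distrib_left)

lemma edge_sum_diff_cmult:
  fixes b :: int
  shows "edge_sum (\<lambda>v. x v - b * y v) e = edge_sum x e - b * edge_sum y e"
  by (simp add: edge_sum_def sum_subtractf sum_distrib_left)

lemma vertex_sum_linear:
  fixes a b :: int
  shows "vertex_sum E (\<lambda>e. a * x e + b * y e) v = a * vertex_sum E x v + b * vertex_sum E y v"
  by (simp add: vertex_sum_def sum.distrib sum_distrib_left)

lemma vertex_sum_insert:
  assumes "finite T" "e \<notin> T"
  shows "vertex_sum (insert e T) z v = (if v \<in> e then z e else 0) + vertex_sum T z v"
proof -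
  have "{f \<in> insert e T. v \<in> f} = (if v \<in> e then insert e {f \<in> T. v \<in> f} else {f \<in> T. v \<in> f})"
    by auto
  then show ?thesis using assms by (simp add: vertex_sum_def)
qed

lemma vertex_sum_cong: "(\<And>e. e \<in> E \<Longrightarrow> x e = y e) \<Longrightarrow> vertex_sum E x v = vertex_sum E y v"
  unfolding vertex_sum_def by (rule sum.cong) auto

lemma vertex_sum_mono_neutral:
  assumes "finite E" "T \<subseteq> E" "\<And>e. e \<in> E - T \<Longrightarrow> z e = 0"
  shows "vertex_sum E z v = vertex_sum T z v"
  unfolding vertex_sum_def by (rule sum.mono_neutral_right) (use assms in auto)

text \<open>Adjointness of the incidence map and its transpose, by counting incidences in two
  ways.\<close>

lemma sum_vertex_sum:
  fixes y :: "'a \<Rightarrow> 'b::comm_semiring_0"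
  assumes "finite V" "finite E" "\<And>e. e \<in> E \<Longrightarrow> e \<subseteq> V"
  shows "(\<Sum>v\<in>V. y v * vertex_sum E z v) = (\<Sum>e\<in>E. edge_sum y e * z e)"
proof -
  have "(\<Sum>v\<in>V. y v * vertex_sum E z v) = (\<Sum>v\<in>V. \<Sum>e | e \<in> E \<and> v \<in> e. y v * z e)"
    by (simp add: vertex_sum_def sum_distrib_left)
  also have "\<dots> = (\<Sum>e\<in>E. \<Sum>v | v \<in> V \<and> v \<in> e. y v * z e)"
    by (rule sum.swap_restrict[OF assms(1,2)])
  also have "\<dots> = (\<Sum>e\<in>E. edge_sum y e * z e)"
  proof (rule sum.cong)
    fix e assume "e \<in> E"
    then have "{v. v \<in> V \<and> v \<in> e} = e" using assms(3) by blast
    then show "(\<Sum>v | v \<in> V \<and> v \<in> e. y v * z e) = edge_sum y e * z e"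
      by (simp add: edge_sum_def sum_distrib_right)
  qed simp
  finally show ?thesis .
qed

text \<open>Trees are grown leaf by leaf, so that facts about them follow by induction. The
  condition \<open>w \<notin> U\<close> makes \<open>{v, w}\<close> a new edge and \<open>w\<close>
  a leaf, and excludes cycles.\<close>

inductive rooted_tree :: "'a \<Rightarrow> 'a set \<Rightarrow> 'a set set \<Rightarrow> bool" for r where
  root: "rooted_tree r {r} {}"
| grow: "rooted_tree r U T \<Longrightarrow> v \<in> U \<Longrightarrow> w \<notin> U \<Longrightarrow> rooted_tree r (insert w U) (insert {v, w} T)"

lemma rooted_tree_basic:
  assumes "rooted_tree r U T"
  shows "finite U" "r \<in> U" "finite T" "card U = Suc (card T)" "\<And>e. e \<in> T \<Longrightarrow> e \<subseteq> U"
proof -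
  have "finite U \<and> r \<in> U \<and> finite T \<and> card U = Suc (card T) \<and> (\<forall>e\<in>T. e \<subseteq> U)"
    using assms
  proof induction
    case (grow U T v w)
    moreover from this have "{v, w} \<notin> T" by blast
    ultimately show ?case by auto
  qed auto
  then show "finite U" "r \<in> U" "finite T" "card U = Suc (card T)" "\<And>e. e \<in> T \<Longrightarrow> e \<subseteq> U" by auto
qed

text \<open>A rooted tree in \<open>G\<close> with the most vertices spans: a walk from
  \<open>r\<close> leaving \<open>U\<close> would contain an edge by which the tree could
  grow.\<close>

lemma spanning_tree_exists:
  assumes G: "simple_graph G" "connected_graph G" and r: "r \<in> vertices G"
  shows "\<exists>T. rooted_tree r (vertices G) T \<and> T \<subseteq> edges G"
proof -
  define P where "P = (\<lambda>U. U \<subseteq> vertices G \<and> (\<exists>T. rooted_tree r U T \<and> T \<subseteq> edges G))"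
  have fin: "finite (vertices G)" using G(1) by (simp add: simple_graph_def)
  have 1: "P {r}" using r rooted_tree.root[of r] unfolding P_def by blast
  have 2: "\<forall>U. P U \<longrightarrow> card U < Suc (card (vertices G))"
    by (auto simp: P_def less_Suc_eq_le intro!: card_mono[OF fin])
  obtain U where U: "P U" and max: "\<And>U'. P U' \<Longrightarrow> card U' \<le> card U"
    using ex_has_greatest_nat[of P "{r}" card, OF 1 2] by auto
  from U obtain T where UV: "U \<subseteq> vertices G" and T: "rooted_tree r U T" "T \<subseteq> edges G"
    unfolding P_def by auto
  note rt = rooted_tree_basic[OF T(1)]
  have "u \<in> U" if "(r, u) \<in> {(x, y). {x, y} \<in> edges G}\<^sup>*" for u
    using that
  proof (induction rule: rtrancl_induct)
    case (step v w)
    show ?case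
    proof (rule ccontr)
      assume w: "w \<notin> U"
      have e: "{v, w} \<in> edges G" using step by simp
      then have "w \<in> vertices G" using G(1) by (auto simp: simple_graph_def)
      moreover have "rooted_tree r (insert w U) (insert {v, w} T)"
        by (rule rooted_tree.grow[OF T(1) step.IH w])
      ultimately have "P (insert w U)" using UV T(2) e unfolding P_def by auto
      then show False using max[of "insert w U"] rt w by simp
    qed
  qed (use rt in simp)
  then have "vertices G \<subseteq> U" using G(2) r unfolding connected_graph_def by blast
  then have "U = vertices G" using UV by (rule subset_antisym[rotated])
  then show ?thesis using T by auto
qed

text \<open>The incidence map is injective on a tree, since the sum at a leaf is the value of its
  only edge. Coefficients are general because both integers and the field with two elements
  occur.\<close>

lemma rooted_tree_vertex_sum_eq_0:
  fixes z :: "'a set \<Rightarrow> 'b::ab_group_add"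
  assumes "rooted_tree r U T" "\<And>v. v \<in> U \<Longrightarrow> vertex_sum T z v = 0" "e \<in> T"
  shows "z e = 0"
proof -
  have "(\<forall>v\<in>U. vertex_sum T z v = 0) \<longrightarrow> (\<forall>e\<in>T. z e = 0)"
    using assms(1)
  proof induction
    case (grow U T v w)
    note rt = rooted_tree_basic[OF grow.hyps(1)]
    have e: "{v, w} \<notin> T" using grow.hyps rt(5) by blast
    have "{e \<in> T. w \<in> e} = {}" using grow.hyps rt(5) by blast
    then have w: "vertex_sum (insert {v, w} T) z w = z {v, w}"
      unfolding vertex_sum_insert[OF rt(3) e] by (simp only: vertex_sum_def) simp
    show ?case
    proof
      assume 0: "\<forall>u\<in>insert w U. vertex_sum (insert {v, w} T) z u = 0"
      then have z0: "z {v, w} = 0" using w by simp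
      have "vertex_sum T z u = 0" if "u \<in> U" for u
        using 0 that z0 by (auto simp: vertex_sum_insert[OF rt(3) e] split: if_splits)
      then show "\<forall>e\<in>insert {v, w} T. z e = 0" using z0 grow.IH by simp
    qed
  qed simp
  then show ?thesis using assms by blast
qed

text \<open>Starting from 0 at the root, the value at each new leaf is forced by the edge that
  attaches it, and it depends linearly on \<open>x\<close>.\<close>

lemma rooted_tree_potential:
  assumes "rooted_tree r U T"
  shows "\<exists>Y. (\<forall>v. int_linear (\<lambda>x. Y x v)) \<and> (\<forall>x. Y x r = 0) \<and> (\<forall>x. \<forall>e\<in>T. edge_sum (Y x) e = x e)"
  using assms
proof induction
  case root
  show ?case by (rule exI[of _ "\<lambda>_ _. 0"]) (simp add: int_linear_def)
next
  case (grow U T v w)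
  note rt = rooted_tree_basic[OF grow.hyps(1)]
  obtain Y where Y: "\<And>v. int_linear (\<lambda>x. Y x v)" "\<And>x. Y x r = 0"
    "\<And>x e. e \<in> T \<Longrightarrow> edge_sum (Y x) e = x e"
    using grow.IH by blast
  define Y' where "Y' = (\<lambda>x. (Y x)(w := x {v, w} - Y x v))"
  have "int_linear (\<lambda>x. Y' x u)" for u
    using Y(1)[of u] Y(1)[of v] by (simp add: Y'_def int_linear_def algebra_simps)
  moreover have "Y' x r = 0" for x using Y(2) rt(2) grow.hyps by (auto simp: Y'_def)
  moreover have "edge_sum (Y' x) e = x e" if "e \<in> insert {v, w} T" for x e
  proof (cases "e = {v, w}")
    case True
    moreover have "v \<noteq> w" using grow.hyps by blast
    ultimately show ?thesis by (simp add: Y'_def)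
  next
    case False
    then have "e \<in> T" using that by simp
    then have "edge_sum (Y' x) e = edge_sum (Y x) e"
      by (intro edge_sum_cong) (use rt(5) grow.hyps in \<open>auto simp: Y'_def\<close>)
    then show ?thesis using Y(3) \<open>e \<in> T\<close> by simp
  qed
  ultimately show ?case by blast
qed

lemma rooted_tree_signs:
  assumes "rooted_tree r U T"
  shows "\<exists>s :: 'a \<Rightarrow> int. s r = 1 \<and> (\<forall>v\<in>U. s v = 1 \<or> s v = - 1) \<and> (\<forall>e\<in>T. edge_sum s e = 0)"
  using assms
proof induction
  case root
  show ?case by (rule exI[of _ "\<lambda>_. 1"]) simp
next
  case (grow U T v w)
  note rt = rooted_tree_basic[OF grow.hyps(1)]
  obtain s where s: "s r = 1" "\<forall>v\<in>U. s v = 1 \<or> s v = (- 1 :: int)" "\<forall>e\<in>T. edge_sum s e = 0"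
    using grow.IH by blast
  define s' where "s' = s(w := - s v)"
  have "v \<noteq> w" "r \<noteq> w" using rt(2) grow.hyps by auto
  have "edge_sum s' e = edge_sum s e" if "e \<in> T" for e
    by (intro edge_sum_cong) (use that rt(5) grow.hyps in \<open>auto simp: s'_def\<close>)
  moreover have "edge_sum s' {v, w} = 0" using \<open>v \<noteq> w\<close> by (simp add: s'_def)
  ultimately have "\<forall>e\<in>insert {v, w} T. edge_sum s' e = 0" using s(3) by simp
  moreover have "s' r = 1" "\<forall>u\<in>insert w U. s' u = 1 \<or> s' u = - 1"
    using s(1,2) grow.hyps \<open>r \<noteq> w\<close> by (auto simp: s'_def)
  ultimately show ?case by blast
qed

text \<open>The kernel of the transposed incidence map of a tree has rank one: a zero edge sum flips
  the sign from one end to the other.\<close>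

lemma rooted_tree_alternating:
  fixes y s :: "'a \<Rightarrow> int"
  assumes "rooted_tree r U T" "\<And>e. e \<in> T \<Longrightarrow> edge_sum y e = 0" "\<And>e. e \<in> T \<Longrightarrow> edge_sum s e = 0"
    and "s r = 1" "v \<in> U"
  shows "y v = y r * s v"
proof -
  have "(\<forall>e\<in>T. edge_sum y e = 0 \<and> edge_sum s e = 0) \<longrightarrow> (\<forall>v\<in>U. y v = y r * s v)"
    using assms(1)
  proof induction
    case (grow U T v w)
    then have "v \<noteq> w" by blast
    show ?case
    proof
      assume 0: "\<forall>e\<in>insert {v, w} T. edge_sum y e = 0 \<and> edge_sum s e = 0"
      then have "y v + y w = 0" "s v + s w = 0" using \<open>v \<noteq> w\<close> by auto
      then have "y w = - y v" "s w = - s v" by simp_all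
      then show "\<forall>u\<in>insert w U. y u = y r * s u" using grow 0 by auto
    qed
  qed (use assms in simp)
  then show ?thesis using assms by blast
qed

text \<open>Edge weights clear the leaves one after the other, and everything is pushed to the
  root.\<close>

lemma rooted_tree_vertex_sum_mod_root:
  fixes y :: "'a \<Rightarrow> int"
  assumes "rooted_tree r U T"
  shows "\<exists>z c. \<forall>v\<in>U. y v = vertex_sum T z v + (if v = r then c else 0)"
  using assms
proof (induction arbitrary: y)
  case root
  show ?case by (auto simp: vertex_sum_def)
next
  case (grow U T v w)
  note rt = rooted_tree_basic[OF grow.hyps(1)]
  have e: "{v, w} \<notin> T" using grow.hyps rt(5) by blast
  \<comment> \<open>The edge \<open>{v, w}\<close> will carry the weight \<open>y w\<close>, which
    is also felt at \<open>v\<close>; hence the correction of \<open>y\<close> there.\<close>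
  obtain z c where z: "\<forall>u\<in>U. (y(v := y v - y w)) u = vertex_sum T z u + (if u = r then c else 0)"
    using grow.IH by blast
  define z' where "z' = z({v, w} := y w)"
  have T: "vertex_sum T z' u = vertex_sum T z u" for u
    by (rule vertex_sum_cong) (use e in \<open>auto simp: z'_def\<close>)
  have "{e \<in> T. w \<in> e} = {}" using grow.hyps rt(5) by blast
  then have "vertex_sum T z w = 0" by (simp only: vertex_sum_def) simp
  moreover have "r \<noteq> w" using rt(2) grow.hyps by blast
  ultimately have w: "y w = vertex_sum (insert {v, w} T) z' w + (if w = r then c else 0)"
    unfolding vertex_sum_insert[OF rt(3) e] T by (simp add: z'_def)
  have "y u = vertex_sum (insert {v, w} T) z' u + (if u = r then c else 0)" if u: "u \<in> U" for u
  proof -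
    have "u \<noteq> w" using u grow.hyps by blast
    then show ?thesis using z[rule_format, OF u] unfolding vertex_sum_insert[OF rt(3) e] T
      by (cases "u = v") (simp_all add: z'_def)
  qed
  with w show ?case by blast
qed

section \<open>The cokernel of the Gram matrix of the incidence matrix\<close>

text \<open>The image of N^t N. Coordinates outside \<open>E\<close> are left free, so that vectors
  may be functions on the whole type.\<close>

definition gram_image :: "'a set set \<Rightarrow> ('a set \<Rightarrow> int) set" where
  "gram_image E = {x. \<exists>z. \<forall>e\<in>E. x e = edge_sum (vertex_sum E z) e}"

text \<open>A vector \<open>x\<close> on the edges is, on the tree \<open>T\<close>, the image under \<open>N\<^sup>t\<close> of the potential \<open>Y x\<close>, which
  is unique up to multiples of the alternating colouring \<open>s\<close>; \<open>residue\<close> measures the failure off \<open>T\<close>.\<close>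

locale tree_potential =
  fixes V :: "'a set" and E T :: "'a set set" and r :: 'a
    and s :: "'a \<Rightarrow> int" and Y :: "('a set \<Rightarrow> int) \<Rightarrow> 'a \<Rightarrow> int"
  assumes finE: "finite E"
    and E: "\<And>e. e \<in> E \<Longrightarrow> e \<subseteq> V \<and> card e = 2"
    and tree: "rooted_tree r V T" and TE: "T \<subseteq> E"
    and s_root: "s r = 1" and s_pm: "\<And>v. v \<in> V \<Longrightarrow> s v = 1 \<or> s v = - 1"
    and s_tree: "\<And>e. e \<in> T \<Longrightarrow> edge_sum s e = 0"
    and Y_linear: "\<And>v. int_linear (\<lambda>x. Y x v)"
    and Y_root: "\<And>x. Y x r = 0"
    and Y_tree: "\<And>x e. e \<in> T \<Longrightarrow> edge_sum (Y x) e = x e"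
begin

definition residue :: "('a set \<Rightarrow> int) \<Rightarrow> 'a set \<Rightarrow> int" where
  "residue x e = x e - edge_sum (Y x) e"

lemma finV: "finite V" and root_in: "r \<in> V"
  using rooted_tree_basic[OF tree] by auto

lemma edge_subset: "e \<in> E \<Longrightarrow> e \<subseteq> V" using E by blast

lemma s_square: "v \<in> V \<Longrightarrow> s v * s v = 1" using s_pm[of v] by auto

lemma edge_sum_cong_V: "e \<in> E \<Longrightarrow> (\<And>v. v \<in> V \<Longrightarrow> x v = y v) \<Longrightarrow> edge_sum x e = edge_sum y e"
  using edge_subset by (intro edge_sum_cong) blast

lemma potential_unique:
  assumes "\<And>e. e \<in> T \<Longrightarrow> edge_sum y e = x e" "v \<in> V"
  shows "Y x v = y v - y r * s v"
proof -
  have "edge_sum (\<lambda>v. y v - 1 * Y x v) e = 0" if "e \<in> T" for e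
    unfolding edge_sum_diff_cmult using assms(1) Y_tree that by simp
  then have "y v - 1 * Y x v = (y r - 1 * Y x r) * s v"
    by (rule rooted_tree_alternating[where y = "\<lambda>v. y v - 1 * Y x v", OF tree _ s_tree s_root assms(2)])
  then show ?thesis using Y_root by simp
qed

text \<open>Any potential \<open>y\<close> that fits on the tree will do; the last term comes from
  normalising it to 0 at the root.\<close>

lemma residue_potential:
  assumes "\<And>e. e \<in> T \<Longrightarrow> edge_sum y e = x e" "e \<in> E"
  shows "residue x e = x e - edge_sum y e + y r * edge_sum s e"
proof -
  have "edge_sum (Y x) e = edge_sum (\<lambda>v. y v - y r * s v) e"
    by (rule edge_sum_cong_V[OF assms(2)]) (rule potential_unique[of y x, OF assms(1)])
  then show ?thesis by (simp add: residue_def edge_sum_diff_cmult)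
qed

lemma residue_tree: "e \<in> T \<Longrightarrow> residue x e = 0"
  by (simp add: residue_def Y_tree)

lemma residue_linear: "int_linear (\<lambda>x. residue x e)"
proof -
  have "Y (\<lambda>e. a * x e + b * y e) = (\<lambda>v. a * Y x v + b * Y y v)" for a b x y
    using int_linearD[OF Y_linear] by blast
  then show ?thesis
    by (simp add: int_linear_def residue_def edge_sum_linear algebra_simps)
qed

lemma sum_vertex_sum_V: "(\<Sum>v\<in>V. y v * vertex_sum E z v) = (\<Sum>e\<in>E. edge_sum y e * z e)"
  for y :: "'a \<Rightarrow> int"
  by (rule sum_vertex_sum[OF finV finE edge_subset])

text \<open>Pairing with \<open>s\<close> finds the root coefficient, because \<open>s\<close> is
  orthogonal to the images of the tree edges.\<close>

lemma vertex_sum_mod_root: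
  fixes y :: "'a \<Rightarrow> int"
  shows "\<exists>z. \<forall>v\<in>V. y v = vertex_sum E z v + (if v = r then \<Sum>u\<in>V. s u * y u else 0)"
proof -
  obtain z c where z: "\<And>v. v \<in> V \<Longrightarrow> y v = vertex_sum T z v + (if v = r then c else 0)"
    using rooted_tree_vertex_sum_mod_root[OF tree] by blast
  define z' where "z' = (\<lambda>e. if e \<in> T then z e else 0)"
  have zz: "vertex_sum E z' v = vertex_sum T z v" for v
  proof -
    have "vertex_sum E z' v = vertex_sum T z' v"
      by (rule vertex_sum_mono_neutral[OF finE TE]) (simp add: z'_def)
    also have "\<dots> = vertex_sum T z v" by (rule vertex_sum_cong) (simp add: z'_def)
    finally show ?thesis .
  qed
  have "(\<Sum>u\<in>V. s u * y u) = (\<Sum>u\<in>V. s u * vertex_sum E z' u + (if u = r then s u * c else 0))"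
    by (rule sum.cong) (auto simp: z zz algebra_simps)
  also have "\<dots> = (\<Sum>u\<in>V. s u * vertex_sum E z' u) + c"
    using finV root_in s_root by (simp add: sum.distrib)
  also have "(\<Sum>u\<in>V. s u * vertex_sum E z' u) = 0"
    unfolding sum_vertex_sum_V by (rule sum.neutral) (simp add: z'_def s_tree)
  finally have "(\<Sum>u\<in>V. s u * y u) = c" by simp
  then show ?thesis by (intro exI[of _ z']) (simp add: z zz)
qed

lemma gram_imageI:
  assumes "\<And>e. e \<in> E \<Longrightarrow> edge_sum y e = x e" "\<And>v. v \<in> V \<Longrightarrow> y v = vertex_sum E z v"
  shows "x \<in> gram_image E"
proof -
  have "x e = edge_sum (vertex_sum E z) e" if "e \<in> E" for e
    using assms(1)[OF that] edge_sum_cong_V[OF that assms(2)] by simp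
  then show ?thesis by (auto simp: gram_image_def)
qed

lemma sum_s_shift: "(\<Sum>v\<in>V. s v * (y v - c * s v)) = (\<Sum>v\<in>V. s v * y v) - c * int (card V)"
proof -
  have "(\<Sum>v\<in>V. s v * (y v - c * s v)) = (\<Sum>v\<in>V. s v * y v - c)"
    by (rule sum.cong) (use s_square in \<open>auto simp: algebra_simps\<close>)
  then show ?thesis by (simp add: sum_subtractf)
qed

subsection \<open>Balanced signs\<close>

text \<open>Vanishing residues mean that \<open>x\<close> has a potential, determined up to a
  multiple of \<open>s\<close>. Some \<open>Y x - c * s\<close> is orthogonal to \<open>s\<close>,
  and so a vertex sum, iff the pairing of \<open>Y x\<close> with \<open>s\<close> is
  \<open>c * card V\<close>.\<close>

lemma presents_bipartite:
  assumes bip: "\<And>e. e \<in> E \<Longrightarrow> edge_sum s e = 0"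
  shows "presents UNIV (gram_image E) (Some ` (E - T) \<union> {None})
    (\<lambda>i. case i of None \<Rightarrow> card V | Some e \<Rightarrow> 0)
    (\<lambda>i x. case i of None \<Rightarrow> \<Sum>v\<in>V. s v * Y x v | Some e \<Rightarrow> residue x e)"
proof (rule presentsI)
  fix i
  show "int_linear (\<lambda>x. case i of None \<Rightarrow> \<Sum>v\<in>V. s v * Y x v | Some e \<Rightarrow> residue x e)"
  proof (cases i)
    case None
    then show ?thesis
      by (simp add: int_linear_def int_linearD[OF Y_linear] sum.distrib sum_distrib_left algebra_simps)
  qed (simp add: residue_linear)
next
  fix t :: "'a set option \<Rightarrow> int"
  define b where "b = t None"
  define y where "y = (\<lambda>v. if v = r then b else 0)"
  define x where "x = (\<lambda>e. edge_sum y e + (if e \<in> T then 0 else t (Some e)))"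
  have xT: "edge_sum y e = x e" if "e \<in> T" for e using that by (simp add: x_def)
  have "residue x e = t (Some e)" if "e \<in> E - T" for e
    using residue_potential[of y x e, OF xT] that bip by (simp add: x_def)
  \<comment> \<open>The extra term comes from normalising the potential at the root; it is a
    multiple of the modulus \<open>card V\<close>.\<close>
  moreover have "(\<Sum>v\<in>V. s v * Y x v) = b - b * int (card V)"
  proof -
    have "(\<Sum>v\<in>V. s v * Y x v) = (\<Sum>v\<in>V. s v * (y v - y r * s v))"
      by (rule sum.cong) (simp_all add: potential_unique[of y x, OF xT])
    also have "\<dots> = (\<Sum>v\<in>V. s v * y v) - y r * int (card V)" by (rule sum_s_shift)
    finally show ?thesis using finV root_in s_root by (simp add: y_def if_distrib cong: if_cong)
  qed
  ultimately show "\<exists>x\<in>UNIV. \<forall>i\<in>Some ` (E - T) \<union> {None}.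
      int (case i of None \<Rightarrow> card V | Some e \<Rightarrow> 0) dvd
      (case i of None \<Rightarrow> \<Sum>v\<in>V. s v * Y x v | Some e \<Rightarrow> residue x e) - t i"
    by (intro bexI[of _ x]) (auto simp: b_def)
next
  fix x :: "'a set \<Rightarrow> int"
  have "x \<in> gram_image E \<longleftrightarrow> (\<forall>e\<in>E - T. residue x e = 0) \<and> int (card V) dvd (\<Sum>v\<in>V. s v * Y x v)"
  proof
    assume "x \<in> gram_image E"
    then obtain z where z: "\<And>e. e \<in> E \<Longrightarrow> edge_sum (vertex_sum E z) e = x e"
      by (auto simp: gram_image_def)
    let ?y = "vertex_sum E z"
    have zT: "edge_sum ?y e = x e" if "e \<in> T" for e using z that TE by blast
    have "residue x e = 0" if "e \<in> E - T" for e
      using residue_potential[of ?y x e, OF zT] that bip z by simp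
    moreover have "(\<Sum>v\<in>V. s v * Y x v) = (\<Sum>v\<in>V. s v * (?y v - ?y r * s v))"
      by (rule sum.cong) (simp_all add: potential_unique[of ?y x, OF zT])
    then have "(\<Sum>v\<in>V. s v * Y x v) = - ?y r * int (card V)"
      unfolding sum_s_shift sum_vertex_sum_V by (simp add: bip)
    ultimately show "(\<forall>e\<in>E - T. residue x e = 0) \<and> int (card V) dvd (\<Sum>v\<in>V. s v * Y x v)"
      by simp
  next
    assume R: "(\<forall>e\<in>E - T. residue x e = 0) \<and> int (card V) dvd (\<Sum>v\<in>V. s v * Y x v)"
    then obtain c where c: "(\<Sum>v\<in>V. s v * Y x v) = c * int (card V)" by (metis dvdE mult.commute)
    define y where "y = (\<lambda>v. Y x v - c * s v)"
    have "residue x e = 0" if "e \<in> E" for e using R residue_tree that by blast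
    then have "edge_sum y e = x e" if "e \<in> E" for e
      using that by (simp add: y_def edge_sum_diff_cmult bip residue_def)
    moreover have 0: "(\<Sum>v\<in>V. s v * y v) = 0" unfolding y_def sum_s_shift c by simp
    obtain z where "\<forall>v\<in>V. y v = vertex_sum E z v + (if v = r then \<Sum>u\<in>V. s u * y u else 0)"
      using vertex_sum_mod_root[of y] by blast
    then have "y v = vertex_sum E z v" if "v \<in> V" for v using that unfolding 0 by simp
    ultimately show "x \<in> gram_image E" by (rule gram_imageI)
  qed
  then show "x \<in> gram_image E \<longleftrightarrow> (\<forall>i\<in>Some ` (E - T) \<union> {None}.
      int (case i of None \<Rightarrow> card V | Some e \<Rightarrow> 0) dvd
      (case i of None \<Rightarrow> \<Sum>v\<in>V. s v * Y x v | Some e \<Rightarrow> residue x e))"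
    by auto
qed

subsection \<open>Unbalanced signs\<close>

context
  fixes e1 :: "'a set" and s1 :: int
  assumes e1: "e1 \<in> E" "edge_sum s e1 = 2 * s1" and s1: "s1 = 1 \<or> s1 = - 1"
begin

definition half_sign :: "'a set \<Rightarrow> int" where
  "half_sign e = edge_sum s e div 2"

text \<open>Adding a multiple of \<open>s\<close> to the potential changes \<open>residue\<close> but not \<open>rel_residue\<close>; correcting the
  potential so that the residue at \<open>e1\<close> vanishes may require a half-integral multiple of \<open>s\<close>.\<close>

definition rel_residue :: "'a set \<Rightarrow> ('a set \<Rightarrow> int) \<Rightarrow> int" where
  "rel_residue e x = residue x e - half_sign e * s1 * residue x e1"

definition sum_s :: int where "sum_s = (\<Sum>v\<in>V. s v)"

lemma s1_square: "s1 * s1 = 1" using s1 by auto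

lemma half_sign: "e \<in> E \<Longrightarrow> edge_sum s e = 2 * half_sign e"
proof -
  assume "e \<in> E"
  then have "card e = 2" "e \<subseteq> V" using E by auto
  then obtain v w where "e = {v, w}" "v \<noteq> w" "v \<in> V" "w \<in> V" by (auto simp: card_2_iff)
  then have "even (edge_sum s e)" using s_pm[of v] s_pm[of w] by auto
  then show ?thesis by (simp add: half_sign_def)
qed

lemma half_sign_e1: "half_sign e1 = s1" by (simp add: half_sign_def e1)

lemma e1_notin_T: "e1 \<notin> T" using s_tree[of e1] e1 s1 by auto

lemma even_sum_s: "even sum_s \<longleftrightarrow> even (card V)"
proof -
  have "even (\<Sum>v\<in>V. s v + 1)" by (rule dvd_sum) (use s_pm in fastforce)
  then show ?thesis by (simp add: sum_s_def sum.distrib)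
qed

lemma rel_residue_linear: "int_linear (rel_residue e)"
  unfolding int_linear_def rel_residue_def
  using int_linearD[OF residue_linear] by (simp add: algebra_simps)

lemma sum_potential:
  assumes "\<And>e. e \<in> T \<Longrightarrow> edge_sum y e = x e"
  shows "(\<Sum>v\<in>V. Y x v) = (\<Sum>v\<in>V. y v) - y r * sum_s"
proof -
  have "(\<Sum>v\<in>V. Y x v) = (\<Sum>v\<in>V. y v - y r * s v)"
    by (rule sum.cong) (simp_all add: potential_unique[of y x, OF assms])
  then show ?thesis by (simp add: sum_subtractf sum_s_def sum_distrib_left)
qed

text \<open>The potential must be \<open>Y x + a * s1 * s\<close> with
  \<open>2 * a = residue x e1\<close>. The three conditions say that it fits on every edge, that
  \<open>a\<close> is an integer, and that its coordinate sum is even. The last one is doubled so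
  that it can be stated without halving the residue.\<close>

lemma gram_image_unbalanced:
  "x \<in> gram_image E \<longleftrightarrow> (\<forall>e\<in>E - T - {e1}. rel_residue e x = 0) \<and> 2 dvd residue x e1 \<and>
     4 dvd 2 * (\<Sum>v\<in>V. Y x v) + residue x e1 * s1 * sum_s"
proof
  assume "x \<in> gram_image E"
  then obtain z where z: "\<And>e. e \<in> E \<Longrightarrow> edge_sum (vertex_sum E z) e = x e"
    by (auto simp: gram_image_def)
  let ?y = "vertex_sum E z"
  have zT: "edge_sum ?y e = x e" if "e \<in> T" for e using z that TE by blast
  have res: "residue x e = ?y r * 2 * half_sign e" if "e \<in> E" for e
    using residue_potential[of ?y x e, OF zT that] z[OF that] half_sign[OF that] by simp
  have "rel_residue e x = 0" if "e \<in> E" for e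
    unfolding rel_residue_def res[OF that] res[OF e1(1)] half_sign_e1
    using s1 by auto
  moreover have "2 dvd residue x e1" using res[OF e1(1)] by simp
  moreover have "4 dvd 2 * (\<Sum>v\<in>V. Y x v) + residue x e1 * s1 * sum_s"
  proof -
    have pot: "(\<Sum>v\<in>V. Y x v) = (\<Sum>v\<in>V. ?y v) - ?y r * sum_s"
      by (rule sum_potential) (rule zT)
    have "2 * (\<Sum>v\<in>V. Y x v) + residue x e1 * s1 * sum_s = 2 * (\<Sum>v\<in>V. ?y v)"
      unfolding pot res[OF e1(1)] half_sign_e1 using s1 by (auto simp: algebra_simps)
    moreover have "(\<Sum>v\<in>V. ?y v) = (\<Sum>e\<in>E. 2 * z e)"
    proof -
      have "(\<Sum>v\<in>V. 1 * ?y v) = (\<Sum>e\<in>E. edge_sum (\<lambda>_. 1) e * z e)" by (rule sum_vertex_sum_V)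
      also have "\<dots> = (\<Sum>e\<in>E. 2 * z e)" by (rule sum.cong) (use E in \<open>auto simp: edge_sum_def\<close>)
      finally show ?thesis by simp
    qed
    ultimately show ?thesis by (simp flip: sum_distrib_left)
  qed
  ultimately show "(\<forall>e\<in>E - T - {e1}. rel_residue e x = 0) \<and> 2 dvd residue x e1 \<and>
     4 dvd 2 * (\<Sum>v\<in>V. Y x v) + residue x e1 * s1 * sum_s" by blast
next
  assume R: "(\<forall>e\<in>E - T - {e1}. rel_residue e x = 0) \<and> 2 dvd residue x e1 \<and>
     4 dvd 2 * (\<Sum>v\<in>V. Y x v) + residue x e1 * s1 * sum_s"
  then obtain a where a: "residue x e1 = 2 * a" by blast
  define y where "y = (\<lambda>v. Y x v + (a * s1) * s v)"
  have yE: "edge_sum y e = x e" if e: "e \<in> E" for e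
  proof -
    have "residue x e = half_sign e * s1 * residue x e1"
    proof -
      consider "e \<in> T" | "e = e1" | "e \<in> E - T - {e1}" using e by blast
      then show ?thesis
      proof cases
        case 1
        then show ?thesis using residue_tree s_tree by (simp add: half_sign_def)
      next
        case 2
        then show ?thesis using half_sign_e1 s1_square by simp
      qed (use R in \<open>auto simp: rel_residue_def\<close>)
    qed
    then have "x e - edge_sum (Y x) e = half_sign e * s1 * (2 * a)"
      unfolding a by (simp only: residue_def)
    then show ?thesis
      unfolding y_def edge_sum_add_cmult half_sign[OF e] by (simp add: algebra_simps)
  qed
  have "(\<Sum>v\<in>V. y v) = (\<Sum>v\<in>V. Y x v) + a * s1 * sum_s"
    by (simp add: y_def sum.distrib sum_s_def sum_distrib_left)
  then have "4 dvd 2 * (\<Sum>v\<in>V. y v)" using R by (simp add: a algebra_simps)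
  then have even_y: "even (\<Sum>v\<in>V. y v)" by presburger
  obtain z where z: "\<And>v. v \<in> V \<Longrightarrow> y v = vertex_sum E z v + (if v = r then \<Sum>u\<in>V. s u * y u else 0)"
    using vertex_sum_mod_root[of y] by blast
  \<comment> \<open>Signs are odd, so pairing with \<open>s\<close> and summing the coordinates give
    the same parity.\<close>
  have "even (\<Sum>u\<in>V. s u * y u - y u)"
  proof (rule dvd_sum)
    fix u assume "u \<in> V"
    then show "even (s u * y u - y u)" using s_pm[of u] by auto
  qed
  then have "even (\<Sum>u\<in>V. s u * y u)" using even_y by (simp add: sum_subtractf)
  then obtain d where d: "(\<Sum>u\<in>V. s u * y u) = 2 * d" by blast
  \<comment> \<open>The edge \<open>e1\<close> closes an odd cycle, so twice the root lies in the image of the incidence map.\<close>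
  define z1 :: "'a set \<Rightarrow> int" where "z1 = (\<lambda>e. of_bool (e = e1))"
  obtain z2 where z2: "\<And>v. v \<in> V \<Longrightarrow> vertex_sum E z1 v =
      vertex_sum E z2 v + (if v = r then \<Sum>u\<in>V. s u * vertex_sum E z1 u else 0)"
    using vertex_sum_mod_root[of "vertex_sum E z1"] by blast
  have "(\<Sum>u\<in>V. s u * vertex_sum E z1 u) = 2 * s1"
  proof -
    have "E \<inter> {e. e = e1} = {e1}" using e1 by auto
    then show ?thesis unfolding sum_vertex_sum_V using finE e1 by (simp add: z1_def)
  qed
  then have two: "vertex_sum E z1 v - vertex_sum E z2 v = (if v = r then 2 * s1 else 0)" if "v \<in> V" for v
    using z2[OF that] by simp
  \<comment> \<open>\<open>z1 - z2\<close> maps to \<open>2 * s1\<close> at the root; times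
    \<open>d * s1\<close> it supplies the value \<open>2 * d\<close> that \<open>z\<close> misses
    there.\<close>
  define z' where "z' = (\<lambda>e. 1 * z e + (d * s1) * (1 * z1 e + (- 1) * z2 e))"
  have "vertex_sum E z' v = y v" if "v \<in> V" for v
  proof -
    have "vertex_sum E z' v = vertex_sum E z v + d * s1 * (vertex_sum E z1 v - vertex_sum E z2 v)"
      unfolding z'_def vertex_sum_linear by simp
    also have "\<dots> = y v" unfolding two[OF that] z[OF that] using s1_square by (simp add: d algebra_simps)
    finally show ?thesis .
  qed
  then show "x \<in> gram_image E" by (intro gram_imageI[where z = z', OF yE]) auto
qed

text \<open>Two free parameters serve both parities of \<open>card V\<close>: \<open>b\<close>,
  placed at the root, moves the potential, and \<open>j\<close> moves the residue at
  \<open>e1\<close>. Adding \<open>j * half_sign e\<close> elsewhere keeps the relative residues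
  fixed.\<close>

lemma unbalanced_surj:
  "\<exists>x. (\<forall>e\<in>E - T - {e1}. rel_residue e x = t e) \<and> residue x e1 = (j + 2 * b) * s1 \<and>
     (\<Sum>v\<in>V. Y x v) = b - b * sum_s"
proof -
  define y where "y = (\<lambda>v. if v = r then b else 0)"
  define x where "x = (\<lambda>e. edge_sum y e +
    (if e \<in> T then 0 else if e = e1 then j * s1 else t e + j * half_sign e))"
  have xT: "edge_sum y e = x e" if "e \<in> T" for e using that by (simp add: x_def)
  have r1: "residue x e1 = (j + 2 * b) * s1"
    using residue_potential[of y x e1, OF xT e1(1)] e1_notin_T half_sign[OF e1(1)]
    by (simp add: x_def y_def half_sign_e1 algebra_simps)
  moreover have "rel_residue e x = t e" if "e \<in> E - T - {e1}" for e
  proof -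
    have "residue x e = t e + j * half_sign e + 2 * b * half_sign e"
      using residue_potential[of y x e, OF xT] that half_sign[of e] by (simp add: x_def y_def algebra_simps)
    then show ?thesis unfolding rel_residue_def r1 using s1 by (auto simp: algebra_simps)
  qed
  moreover have "(\<Sum>v\<in>V. Y x v) = (\<Sum>v\<in>V. y v) - y r * sum_s"
    by (rule sum_potential) (rule xT)
  then have "(\<Sum>v\<in>V. Y x v) = b - b * sum_s" using finV root_in by (simp add: y_def)
  ultimately show ?thesis by blast
qed

text \<open>Here \<open>sum_s\<close> is odd, so the condition modulo 4 already forces the residue
  at \<open>e1\<close> to be even, and one cyclic factor remains.\<close>

lemma presents_odd:
  assumes odd: "odd (card V)"
  shows "presents UNIV (gram_image E) (Some ` (E - T - {e1}) \<union> {None})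
    (\<lambda>i. case i of None \<Rightarrow> 4 | Some e \<Rightarrow> 0)
    (\<lambda>i x. case i of None \<Rightarrow> 2 * (\<Sum>v\<in>V. Y x v) + residue x e1 * s1 * sum_s
                   | Some e \<Rightarrow> rel_residue e x)"
proof (rule presentsI)
  fix i
  show "int_linear (\<lambda>x. case i of None \<Rightarrow> 2 * (\<Sum>v\<in>V. Y x v) + residue x e1 * s1 * sum_s
                   | Some e \<Rightarrow> rel_residue e x)"
  proof (cases i)
    case None
    then show ?thesis
      by (simp add: int_linear_def int_linearD[OF Y_linear] int_linearD[OF residue_linear]
          sum.distrib sum_distrib_left algebra_simps)
  next
    case (Some e)
    then show ?thesis using rel_residue_linear[of e] by simp
  qed
next
  fix t :: "'a set option \<Rightarrow> int"
  \<comment> \<open>\<open>j\<close> is scaled by \<open>sum_s\<close> because an odd number is its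
    own inverse modulo 4.\<close>
  obtain x where x: "\<And>e. e \<in> E - T - {e1} \<Longrightarrow> rel_residue e x = t (Some e)"
    "residue x e1 = (t None * sum_s + 2 * 0) * s1" "(\<Sum>v\<in>V. Y x v) = 0 - 0 * sum_s"
    using unbalanced_surj[of "\<lambda>e. t (Some e)" "t None * sum_s" 0] by blast
  have "4 dvd 2 * (\<Sum>v\<in>V. Y x v) + residue x e1 * s1 * sum_s - t None"
  proof -
    obtain k where k: "sum_s = 2 * k + 1" using odd even_sum_s by (metis oddE)
    have "2 * (\<Sum>v\<in>V. Y x v) + residue x e1 * s1 * sum_s - t None = t None * (sum_s * sum_s - 1)"
      unfolding x(2,3) using s1 by (auto simp: algebra_simps)
    also have "\<dots> = 4 * (t None * (k * k + k))" by (simp add: k algebra_simps)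
    finally show ?thesis by simp
  qed
  then show "\<exists>x\<in>UNIV. \<forall>i\<in>Some ` (E - T - {e1}) \<union> {None}.
      int (case i of None \<Rightarrow> 4 | Some e \<Rightarrow> 0) dvd
      (case i of None \<Rightarrow> 2 * (\<Sum>v\<in>V. Y x v) + residue x e1 * s1 * sum_s
               | Some e \<Rightarrow> rel_residue e x) - t i"
    using x(1) by (intro bexI[of _ x]) auto
next
  fix x :: "'a set \<Rightarrow> int"
  have "even (residue x e1)" if "4 dvd 2 * (\<Sum>v\<in>V. Y x v) + residue x e1 * s1 * sum_s"
  proof -
    have "even (2 * (\<Sum>v\<in>V. Y x v) + residue x e1 * s1 * sum_s)"
      using that by (meson dvd_trans even_numeral)
    moreover have "odd (s1 * sum_s)" using odd even_sum_s s1 by auto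
    ultimately show ?thesis by (auto simp: mult.assoc)
  qed
  then show "x \<in> gram_image E \<longleftrightarrow> (\<forall>i\<in>Some ` (E - T - {e1}) \<union> {None}.
      int (case i of None \<Rightarrow> 4 | Some e \<Rightarrow> 0) dvd
      (case i of None \<Rightarrow> 2 * (\<Sum>v\<in>V. Y x v) + residue x e1 * s1 * sum_s
               | Some e \<Rightarrow> rel_residue e x))"
    unfolding gram_image_unbalanced by auto
qed

text \<open>Here \<open>sum_s\<close> is even, so the condition modulo 4 can be halved and becomes
  independent of the parity of the residue at \<open>e1\<close>. The index \<open>Some e1\<close>,
  free of a relative residue, carries that second condition.\<close>

lemma presents_even:
  assumes even: "even (card V)"
  shows "presents UNIV (gram_image E) (Some ` (E - T - {e1}) \<union> {Some e1, None})
    (\<lambda>i. case i of None \<Rightarrow> 2 | Some e \<Rightarrow> if e = e1 then 2 else 0)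
    (\<lambda>i x. case i of None \<Rightarrow> (\<Sum>v\<in>V. Y x v) + residue x e1 * s1 * (sum_s div 2)
                   | Some e \<Rightarrow> if e = e1 then residue x e1 else rel_residue e x)"
proof (rule presentsI)
  fix i
  show "int_linear (\<lambda>x. case i of None \<Rightarrow> (\<Sum>v\<in>V. Y x v) + residue x e1 * s1 * (sum_s div 2)
                   | Some e \<Rightarrow> if e = e1 then residue x e1 else rel_residue e x)"
  proof (cases i)
    case None
    then show ?thesis
      by (simp add: int_linear_def int_linearD[OF Y_linear] int_linearD[OF residue_linear]
          sum.distrib sum_distrib_left algebra_simps)
  next
    case (Some e)
    then show ?thesis using rel_residue_linear[of e] residue_linear[of e1] by (cases "e = e1") simp_all
  qed
next
  fix t :: "'a set option \<Rightarrow> int"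
  define j where "j = t (Some e1) * s1"
  \<comment> \<open>With \<open>sum_s = 2 * k\<close> the functional at \<open>None\<close> takes
    the value \<open>b + j * k\<close>; \<open>b\<close> solves for \<open>t None\<close> and
    changes the residue at \<open>e1\<close> only by an even number.\<close>
  define b where "b = t None - j * (sum_s div 2)"
  obtain x where x: "\<And>e. e \<in> E - T - {e1} \<Longrightarrow> rel_residue e x = t (Some e)"
    "residue x e1 = (j + 2 * b) * s1" "(\<Sum>v\<in>V. Y x v) = b - b * sum_s"
    using unbalanced_surj[of "\<lambda>e. t (Some e)" j b] by blast
  obtain k where k: "sum_s = 2 * k" using even even_sum_s by blast
  have "(\<Sum>v\<in>V. Y x v) + residue x e1 * s1 * (sum_s div 2) = t None"
    unfolding x(2,3) using s1 by (auto simp: k b_def algebra_simps)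
  moreover have "even (residue x e1 - t (Some e1))"
    unfolding x(2) j_def using s1 by (auto simp: algebra_simps)
  ultimately show "\<exists>x\<in>UNIV. \<forall>i\<in>Some ` (E - T - {e1}) \<union> {Some e1, None}.
      int (case i of None \<Rightarrow> 2 | Some e \<Rightarrow> if e = e1 then 2 else 0) dvd
      (case i of None \<Rightarrow> (\<Sum>v\<in>V. Y x v) + residue x e1 * s1 * (sum_s div 2)
               | Some e \<Rightarrow> if e = e1 then residue x e1 else rel_residue e x) - t i"
    using x(1) by (intro bexI[of _ x]) auto
next
  fix x :: "'a set \<Rightarrow> int"
  obtain k where k: "sum_s = 2 * k" using even even_sum_s by blast
  have "4 dvd 2 * (\<Sum>v\<in>V. Y x v) + residue x e1 * s1 * sum_s \<longleftrightarrow>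
      2 dvd (\<Sum>v\<in>V. Y x v) + residue x e1 * s1 * (sum_s div 2)"
  proof -
    have "2 * (\<Sum>v\<in>V. Y x v) + residue x e1 * s1 * sum_s
        = 2 * ((\<Sum>v\<in>V. Y x v) + residue x e1 * s1 * (sum_s div 2))"
      by (simp add: k algebra_simps)
    moreover have "4 dvd 2 * b \<longleftrightarrow> 2 dvd b" for b :: int by presburger
    ultimately show ?thesis by metis
  qed
  then show "x \<in> gram_image E \<longleftrightarrow> (\<forall>i\<in>Some ` (E - T - {e1}) \<union> {Some e1, None}.
      int (case i of None \<Rightarrow> 2 | Some e \<Rightarrow> if e = e1 then 2 else 0) dvd
      (case i of None \<Rightarrow> (\<Sum>v\<in>V. Y x v) + residue x e1 * s1 * (sum_s div 2)
               | Some e \<Rightarrow> if e = e1 then residue x e1 else rel_residue e x))"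
    unfolding gram_image_unbalanced by auto
qed

end

end

section \<open>Fundamental cycles\<close>

lemma rooted_tree_path:
  assumes "rooted_tree r U T" "u \<in> U" "v \<in> U"
  shows "\<exists>p. p \<noteq> [] \<and> hd p = u \<and> last p = v \<and> distinct p \<and> set p \<subseteq> U \<and>
    successively (\<lambda>a b. {a, b} \<in> T) p"
  using assms
proof (induction arbitrary: u v)
  case root
  then show ?case by (intro exI[of _ "[r]"]) simp
next
  case (grow U T x w)
  have mono: "successively (\<lambda>a b. {a, b} \<in> insert {x, w} T) p"
    if "successively (\<lambda>a b. {a, b} \<in> T) p" for p
    using that by (rule successively_mono) simp
  consider "u \<in> U" "v \<in> U" | "u \<in> U" "v = w" | "u = w" "v \<in> U" | "u = w" "v = w"
    using grow.prems by blast
  then show ?case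
  proof cases
    case 1
    from grow.IH[OF this] show ?thesis using mono by blast
  next
    case 2
    from grow.IH[OF 2(1) grow.hyps(2)] obtain p where p: "p \<noteq> []" "hd p = u" "last p = x"
      "distinct p" "set p \<subseteq> U" "successively (\<lambda>a b. {a, b} \<in> T) p" by blast
    then show ?thesis using 2 grow.hyps(3) mono[OF p(6)]
      by (intro exI[of _ "p @ [w]"]) (auto simp: successively_append_iff)
  next
    case 3
    from grow.IH[OF grow.hyps(2) 3(2)] obtain p where p: "p \<noteq> []" "hd p = x" "last p = v"
      "distinct p" "set p \<subseteq> U" "successively (\<lambda>a b. {a, b} \<in> T) p" by blast
    then show ?thesis using 3 grow.hyps(3) mono[OF p(6)]
      by (intro exI[of _ "w # p"]) (auto simp: successively_Cons insert_commute)
  next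
    case 4
    then show ?thesis by (intro exI[of _ "[w]"]) simp
  qed
qed

text \<open>The tree path between the ends of \<open>e\<close> is closed up by \<open>e\<close>. It
  has at least three vertices, since a path of one edge would be \<open>e\<close> itself, which is
  not in \<open>T\<close>.\<close>

lemma fundamental_cycle:
  assumes G: "simple_graph G" and T: "rooted_tree r (vertices G) T" "T \<subseteq> edges G"
    and e: "e \<in> edges G - T"
  shows "\<exists>c. is_cycle G c \<and> e \<in> cycle_edges c \<and> cycle_edges c \<subseteq> insert e T"
proof -
  have "e \<subseteq> vertices G" "card e = 2" using G e by (auto simp: simple_graph_def)
  then obtain u v where uv: "e = {u, v}" "u \<noteq> v" "u \<in> vertices G" "v \<in> vertices G"
    by (auto simp: card_2_iff)
  obtain p where p: "p \<noteq> []" "hd p = u" "last p = v" "distinct p"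
    "successively (\<lambda>a b. {a, b} \<in> T) p"
    using rooted_tree_path[OF T(1) uv(3,4)] by blast
  have step: "{p ! i, p ! Suc i} \<in> T" if "Suc i < length p" for i
    using p(5) that by (simp add: successively_conv_nth)
  have ends: "p ! 0 = u" "p ! (length p - 1) = v" using p by (simp_all add: hd_conv_nth last_conv_nth)
  have len: "3 \<le> length p"
  proof (rule ccontr)
    assume "\<not> 3 \<le> length p"
    moreover have "length p \<noteq> 0" using p by simp
    ultimately consider "length p = 1" | "length p = 2" by linarith
    then show False
    proof cases
      case 1
      then show False using ends uv by simp
    next
      case 2
      then show False using step[of 0] ends uv e by simp
    qed
  qed
  \<comment> \<open>Only the last index wraps around, and it yields the closing edge
    \<open>e\<close>.\<close>
  have edge: "{p ! i, p ! (Suc i mod length p)} = (if Suc i < length p then {p ! i, p ! Suc i} else e)"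
    if "i < length p" for i
  proof (cases "Suc i < length p")
    case False
    then have "Suc i = length p" using that by simp
    then show ?thesis using ends uv by (auto simp flip: \<open>Suc i = length p\<close>)
  qed simp
  have "cycle_edges p \<subseteq> insert e T" using edge step by (auto simp: cycle_edges_def)
  moreover have "e \<in> cycle_edges p"
    unfolding cycle_edges_def using edge[of "length p - 1"] len
    by (intro image_eqI[of _ _ "length p - 1"]) auto
  ultimately show ?thesis
    using len p T e unfolding is_cycle_def by (intro exI[of _ p]) auto
qed

section \<open>Weights along a cycle that cancel at every vertex\<close>

context
  fixes G :: "'a sgraph" and c :: "'a list"
  assumes cyc: "is_cycle G c"
begin

private definition \<sigma> :: "nat \<Rightarrow> nat" where "\<sigma> i = Suc i mod length c"
private definition cedge :: "nat \<Rightarrow> 'a set" where "cedge i = {c ! i, c ! \<sigma> i}"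

lemma cycle_facts: "3 \<le> length c" "distinct c" "cycle_edges c \<subseteq> edges G"
  using cyc by (auto simp: is_cycle_def)

private lemma cycle_edges_image: "cycle_edges c = cedge ` {..<length c}"
  by (simp add: cycle_edges_def cedge_def \<sigma>_def)

private lemma \<sigma>_less: "i < length c \<Longrightarrow> \<sigma> i < length c"
  unfolding \<sigma>_def by (rule mod_less_divisor) linarith

private lemma \<sigma>_eq: "i < length c \<Longrightarrow> \<sigma> i = (if Suc i = length c then 0 else Suc i)"
  by (auto simp: \<sigma>_def)

private lemma \<sigma>_bij: "bij_betw \<sigma> {..<length c} {..<length c}"
proof -
  have "inj_on \<sigma> {..<length c}" by (auto simp: inj_on_def \<sigma>_eq split: if_splits)
  moreover have "\<sigma> ` {..<length c} \<subseteq> {..<length c}" using \<sigma>_less by auto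
  ultimately show ?thesis by (simp add: bij_betw_def endo_inj_surj)
qed

text \<open>Equal edges at different positions would make each position the successor of the other,
  which needs a cycle of length 2.\<close>

private lemma cedge_inj: "inj_on cedge {..<length c}"
proof (rule inj_onI)
  fix i j assume ij: "i \<in> {..<length c}" "j \<in> {..<length c}" "cedge i = cedge j"
  then have "i = j \<or> (i = \<sigma> j \<and> \<sigma> i = j)"
    using cycle_facts(2) \<sigma>_less by (auto simp: cedge_def doubleton_eq_iff nth_eq_iff_index_eq)
  then show "i = j" using ij cycle_facts(1) by (auto simp: \<sigma>_eq split: if_splits)
qed

private definition weight :: "(nat \<Rightarrow> 'b::comm_ring_1) \<Rightarrow> 'a set \<Rightarrow> 'b" where
  "weight a e = (\<Sum>i<length c. of_bool (e = cedge i) * a i)"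

private lemma weight_cedge: "i < length c \<Longrightarrow> weight a (cedge i) = a i"
proof -
  assume i: "i < length c"
  have "{..<length c} \<inter> {j. cedge i = cedge j} = {i}" using inj_onD[OF cedge_inj] i by auto
  then show ?thesis by (simp add: weight_def)
qed

private lemma weight_outside: "e \<notin> cycle_edges c \<Longrightarrow> weight a e = 0"
  unfolding weight_def by (rule sum.neutral) (auto simp: cycle_edges_image)

text \<open>A vertex of the cycle meets two consecutive edges, whose weights cancel. This covers
  constant weight 1 in characteristic 2 and alternating signs over the integers.\<close>

private lemma vertex_sum_weight:
  fixes a :: "nat \<Rightarrow> 'b::comm_ring_1"
  assumes fin: "finite (edges G)" and a: "\<And>i. i < length c \<Longrightarrow> a i + a (\<sigma> i) = 0"
  shows "vertex_sum (edges G) (weight a) v = 0"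
proof -
  have "vertex_sum (edges G) (weight a) v
      = (\<Sum>i<length c. \<Sum>e | e \<in> edges G \<and> v \<in> e. of_bool (e = cedge i) * a i)"
    unfolding vertex_sum_def weight_def by (rule sum.swap)
  also have "\<dots> = (\<Sum>i<length c. of_bool (v = c ! i) * a i + of_bool (v = c ! \<sigma> i) * a i)"
  proof (rule sum.cong)
    fix i assume i: "i \<in> {..<length c}"
    have "cedge i \<in> edges G" using cycle_facts(3) i by (auto simp: cycle_edges_image)
    then have *: "{e. e \<in> edges G \<and> v \<in> e} \<inter> {e. e = cedge i} = (if v \<in> cedge i then {cedge i} else {})"
      by auto
    have "\<sigma> i \<noteq> i" using i cycle_facts(1) by (auto simp: \<sigma>_eq)
    then have "c ! i \<noteq> c ! \<sigma> i"
      using i cycle_facts(2) \<sigma>_less by (simp add: nth_eq_iff_index_eq)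
    then show "(\<Sum>e | e \<in> edges G \<and> v \<in> e. of_bool (e = cedge i) * a i)
        = of_bool (v = c ! i) * a i + of_bool (v = c ! \<sigma> i) * a i"
      using fin * by (auto simp: cedge_def)
  qed simp
  also have "\<dots> = (\<Sum>i<length c. of_bool (v = c ! i) * a i) + (\<Sum>i<length c. of_bool (v = c ! \<sigma> i) * a i)"
    by (rule sum.distrib)
  also have "(\<Sum>i<length c. of_bool (v = c ! i) * a i) = (\<Sum>i<length c. of_bool (v = c ! \<sigma> i) * a (\<sigma> i))"
    by (rule sum.reindex_bij_betw[OF \<sigma>_bij, symmetric])
  also have "\<dots> + (\<Sum>i<length c. of_bool (v = c ! \<sigma> i) * a i)
      = (\<Sum>i<length c. of_bool (v = c ! \<sigma> i) * (a i + a (\<sigma> i)))"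
    by (simp add: sum.distrib algebra_simps)
  also have "\<dots> = 0" by (rule sum.neutral) (simp add: a)
  finally show ?thesis .
qed

lemma vertex_sum_cycle_indicator:
  assumes "finite (edges G)"
  shows "vertex_sum (edges G) (\<lambda>e. of_bool (e \<in> cycle_edges c) :: bit) v = 0"
proof -
  have "weight (\<lambda>_. 1 :: bit) e = of_bool (e \<in> cycle_edges c)" for e
  proof (cases "e \<in> cycle_edges c")
    case True
    then obtain i where "i < length c" "e = cedge i" by (auto simp: cycle_edges_image)
    then show ?thesis using weight_cedge[of i "\<lambda>_. 1 :: bit"] True by simp
  qed (simp add: weight_outside)
  then have "(\<lambda>e. of_bool (e \<in> cycle_edges c) :: bit) = weight (\<lambda>_. 1)" by auto
  then show ?thesis using vertex_sum_weight[OF assms, of "\<lambda>_. 1 :: bit"] by simp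
qed

text \<open>Alternating signs match up across the closing edge because its index,
  \<open>length c - 1\<close>, is odd. The result is a nonzero kernel vector of the incidence
  map.\<close>

lemma even_cycle_alternating:
  assumes fin: "finite (edges G)" and ev: "even (length c)"
  shows "\<exists>z :: 'a set \<Rightarrow> int. (\<exists>e\<in>edges G. z e \<noteq> 0) \<and> (\<forall>v. vertex_sum (edges G) z v = 0)"
proof (intro exI conjI allI)
  have "(- 1) ^ i + (- 1) ^ \<sigma> i = (0 :: int)" if "i < length c" for i
  proof (cases "Suc i = length c")
    case True
    then have "odd i" using ev by (metis even_Suc)
    then show ?thesis using that True by (simp add: \<sigma>_eq)
  qed (use that in \<open>simp add: \<sigma>_eq\<close>)
  then show "vertex_sum (edges G) (weight (\<lambda>i. (- 1) ^ i :: int)) v = 0" for v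
    by (intro vertex_sum_weight[OF fin])
  have "0 < length c" using cycle_facts(1) by linarith
  then have "cedge 0 \<in> edges G" "weight (\<lambda>i. (- 1) ^ i :: int) (cedge 0) \<noteq> 0"
    using cycle_facts(3) by (auto simp: cycle_edges_image weight_cedge)
  then show "\<exists>e\<in>edges G. weight (\<lambda>i. (- 1) ^ i :: int) e \<noteq> 0" by blast
qed

end

section \<open>Fundamental cycles as a basis of the cycle space\<close>

lemma sum_fun_app: "(\<Sum>i\<in>I. g i) x = (\<Sum>i\<in>I. g i x :: 'b::comm_monoid_add)"
  by (induction I rule: infinite_finite_induct) simp_all

text \<open>Fundamental cycles are independent by their coordinates off the tree. They span, because
  a cycle minus its fundamental combination lives on the tree, has zero vertex sums, and so
  vanishes.\<close>

lemma cyclomatic_number_eq: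
  assumes G: "simple_graph G" and fin: "finite (edges G)"
    and T: "rooted_tree r (vertices G) T" "T \<subseteq> edges G"
  shows "cyclomatic_number G = card (edges G - T)"
proof -
  \<comment> \<open>Keeps bit arithmetic in ring form, as the lemmas about sums need it.\<close>
  note [simp del] = add_bit_eq_xor mult_bit_eq_and
  let ?E = "edges G" and ?S = "(\<lambda>c e. of_bool (e \<in> cycle_edges c) :: bit) ` {c. is_cycle G c}"
  obtain C where C: "\<And>e. e \<in> ?E - T \<Longrightarrow> is_cycle G (C e) \<and> e \<in> cycle_edges (C e) \<and> cycle_edges (C e) \<subseteq> insert e T"
    using fundamental_cycle[OF G T] by metis
  define b where "b = (\<lambda>e f. of_bool (f \<in> cycle_edges (C e)) :: bit)"
  have b_coord: "b e f = of_bool (e = f)" if "e \<in> ?E - T" "f \<in> ?E - T" for e f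
    using C[OF that(1)] that by (auto simp: b_def)
  have inj: "inj_on b (?E - T)"
  proof (rule inj_onI)
    fix e f assume "e \<in> ?E - T" "f \<in> ?E - T" "b e = b f"
    then show "e = f" using b_coord[of e f] b_coord[of f f] by (auto split: if_splits)
  qed
  have "card (b ` (?E - T)) = gf2_dim ?S"
  proof (rule gf2.basis_card_eq_dim)
    show "b ` (?E - T) \<subseteq> ?S" using C by (auto simp: b_def)
    show "\<not> gf2.dependent (b ` (?E - T))"
    proof
      assume "gf2.dependent (b ` (?E - T))"
      then obtain e where e: "e \<in> ?E - T" "b e \<in> gf2.span (b ` (?E - T) - {b e})"
        unfolding gf2.dependent_def by blast
      have "gf2.span (b ` (?E - T) - {b e}) \<subseteq> {f. f e = 0}"
      proof (rule gf2.span_minimal)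
        show "b ` (?E - T) - {b e} \<subseteq> {f. f e = 0}" using b_coord e by auto
        show "gf2.subspace {f. f e = 0}" by (simp add: gf2.subspace_def)
      qed
      then show False using e b_coord[OF e(1) e(1)] by auto
    qed
    show "?S \<subseteq> gf2.span (b ` (?E - T))"
    proof
      fix x assume "x \<in> ?S"
      then obtain c where c: "is_cycle G c" "x = (\<lambda>e. of_bool (e \<in> cycle_edges c))" by blast
      \<comment> \<open>A difference, written as a sum in characteristic 2.\<close>
      define d where "d = (\<lambda>e. x e + (\<Sum>f\<in>?E - T. x f * b f e))"
      have off: "d e = 0" if "e \<in> ?E - T" for e
      proof -
        have "(\<Sum>f\<in>?E - T. x f * b f e) = (\<Sum>f\<in>?E - T. x f * of_bool (f = e))"
          by (rule sum.cong) (use b_coord that in auto)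
        also have "\<dots> = x e"
        proof -
          have "(?E - T) \<inter> {f. f = e} = {e}" using that by auto
          then show ?thesis using fin by simp
        qed
        finally show ?thesis by (simp add: d_def)
      qed
      have "vertex_sum ?E d v = 0" for v
      proof -
        have "vertex_sum ?E d v = vertex_sum ?E x v + (\<Sum>f\<in>?E - T. x f * vertex_sum ?E (b f) v)"
          unfolding d_def vertex_sum_def sum.distrib
          by (subst sum.swap) (simp add: sum_distrib_left)
        also have "vertex_sum ?E x v = 0"
          unfolding c(2) by (rule vertex_sum_cycle_indicator[OF c(1) fin])
        also have "(\<Sum>f\<in>?E - T. x f * vertex_sum ?E (b f) v) = 0"
        proof (intro sum.neutral ballI)
          fix f assume "f \<in> ?E - T"
          then have "is_cycle G (C f)" using C by blast
          then show "x f * vertex_sum ?E (b f) v = 0"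
            unfolding b_def by (simp add: vertex_sum_cycle_indicator fin)
        qed
        finally show ?thesis by simp
      qed
      moreover have "vertex_sum ?E d v = vertex_sum T d v" for v
        by (rule vertex_sum_mono_neutral[OF fin T(2)]) (rule off)
      ultimately have "vertex_sum T d v = 0" for v by simp
      then have "d e = 0" if "e \<in> T" for e
        using rooted_tree_vertex_sum_eq_0[OF T(1) _ that] by blast
      moreover have "d e = 0" if "e \<notin> ?E"
        for e
      proof -
        have "b f e = 0" if "f \<in> ?E - T" for f
          using C[OF that] \<open>e \<notin> ?E\<close> that T(2) by (auto simp: b_def)
        moreover have "x e = 0" using cycle_facts(3)[OF c(1)] \<open>e \<notin> ?E\<close> by (auto simp: c(2))
        ultimately show ?thesis by (simp add: d_def)
      qed
      ultimately have "d e = 0" for e using off by blast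
      then have "x e + (\<Sum>f\<in>?E - T. x f * b f e) = 0" for e
        unfolding d_def by blast
      moreover have "u = w" if "u + w = 0" for u w :: bit
        using that by (cases u; cases w) simp_all
      ultimately have "x = (\<Sum>f\<in>?E - T. (\<lambda>e. x f * b f e))"
        by (simp add: fun_eq_iff sum_fun_app)
      also have "\<dots> \<in> gf2.span (b ` (?E - T))"
        by (intro gf2.span_sum gf2.span_scale gf2.span_base) auto
      finally show "x \<in> gf2.span (b ` (?E - T))" .
    qed
  qed
  then show ?thesis unfolding cyclomatic_number_def by (simp add: card_image[OF inj])
qed

section \<open>Line graphs\<close>

lemma vertices_line_graph [simp]: "vertices (line_graph G) = edges G"
  by (simp add: line_graph_def)

lemma line_graph_adjacent:
  "{e, f} \<in> edges (line_graph G) \<longleftrightarrow> e \<in> edges G \<and> f \<in> edges G \<and> e \<noteq> f \<and> e \<inter> f \<noteq> {}"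
  by (auto simp: line_graph_def doubleton_eq_iff)

lemma finite_edges: "simple_graph G \<Longrightarrow> finite (edges G)"
  by (rule finite_subset[of _ "Pow (vertices G)"]) (auto simp: simple_graph_def)

lemma simple_line_graph:
  assumes "simple_graph G" shows "simple_graph (line_graph G)"
proof -
  have "e \<subseteq> edges G \<and> card e = 2" if "e \<in> edges (line_graph G)" for e
  proof -
    obtain a b where "e = {a, b}" "a \<noteq> b" "a \<in> edges G" "b \<in> edges G"
      using \<open>e \<in> edges (line_graph G)\<close> by (auto simp: line_graph_def)
    then show ?thesis by simp
  qed
  then show ?thesis using finite_edges[OF assms] by (simp add: simple_graph_def)
qed

text \<open>Along a walk in \<open>G\<close> the invariant is that every edge at the current vertex
  is reachable from \<open>e\<close>.\<close>

lemma connected_line_graph: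
  assumes G: "simple_graph G" "connected_graph G" and ne: "edges G \<noteq> {}"
  shows "connected_graph (line_graph G)"
proof -
  let ?L = "{(x, y). {x, y} \<in> edges (line_graph G)}"
  have adj: "(e, f) \<in> ?L\<^sup>*" if "e \<in> edges G" "f \<in> edges G" "v \<in> e" "v \<in> f" for e f v
    using that by (cases "e = f") (auto simp: line_graph_adjacent intro!: r_into_rtrancl)
  have "(e, f) \<in> ?L\<^sup>*" if ef: "e \<in> edges G" "f \<in> edges G" for e f
  proof -
    have "e \<noteq> {}" "f \<noteq> {}" "e \<subseteq> vertices G" "f \<subseteq> vertices G"
      using G(1) ef by (auto simp: simple_graph_def)
    then obtain u v where uv: "u \<in> e" "v \<in> f" "u \<in> vertices G" "v \<in> vertices G" by blast
    then have "(u, v) \<in> {(x, y). {x, y} \<in> edges G}\<^sup>*" using G(2) by (simp add: connected_graph_def)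
    then have "\<forall>g\<in>edges G. v \<in> g \<longrightarrow> (e, g) \<in> ?L\<^sup>*"
    proof (induction rule: rtrancl_induct)
      case base
      then show ?case using adj[OF ef(1)] uv(1) by blast
    next
      case (step v w)
      then have vw: "{v, w} \<in> edges G" by simp
      then have "(e, {v, w}) \<in> ?L\<^sup>*" using step.IH by simp
      moreover have "({v, w}, g) \<in> ?L\<^sup>*" if "g \<in> edges G" "w \<in> g" for g
        using adj[OF vw that(1), of w] that(2) by simp
      ultimately show ?case by (meson rtrancl_trans)
    qed
    then show ?thesis using ef(2) uv(2) by blast
  qed
  then show ?thesis using ne by (simp add: connected_graph_def)
qed

text \<open>The neighbours of \<open>e\<close> are the other edges at its two ends; by simplicity no
  other edge contains both ends. As \<open>e\<close> itself contributes 0, the sum splits into two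
  full stars.\<close>

lemma laplace_fun_line_graph:
  assumes G: "simple_graph G" and e: "e \<in> edges G"
  shows "laplace_fun (line_graph G) y e
    = edge_sum (\<lambda>v. int (vdegree G v)) e * y e - edge_sum (vertex_sum (edges G) y) e"
proof -
  let ?E = "edges G"
  have card2: "f \<in> ?E \<Longrightarrow> card f = 2" for f using G by (simp add: simple_graph_def)
  obtain v w where vw: "e = {v, w}" "v \<noteq> w" using card2[OF e] by (auto simp: card_2_iff)
  have fin: "finite {f. f \<in> ?E \<and> P f}" for P using finite_edges[OF G] by simp
  have eq: "f = e" if "f \<in> ?E" "v \<in> f" "w \<in> f" for f
    using card2[OF that(1)] that vw by (auto simp: card_2_iff)
  define g where "g = (\<lambda>f. y e - y f)"
  have vs: "vertex_sum ?E g u = int (vdegree G u) * y e - vertex_sum ?E y u" for u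
    by (simp add: vertex_sum_def g_def sum_subtractf vdegree_def)
  have ve: "sum g ({f. f \<in> ?E \<and> u \<in> f} - {e}) = vertex_sum ?E g u" for u
    unfolding vertex_sum_def by (rule sum.mono_neutral_left) (use fin in \<open>auto simp: g_def\<close>)
  have "{f. {e, f} \<in> edges (line_graph G)} = ({f. f \<in> ?E \<and> v \<in> f} - {e}) \<union> ({f. f \<in> ?E \<and> w \<in> f} - {e})"
    using e vw by (auto simp: line_graph_adjacent)
  then have "laplace_fun (line_graph G) y e
      = sum g (({f. f \<in> ?E \<and> v \<in> f} - {e}) \<union> ({f. f \<in> ?E \<and> w \<in> f} - {e}))"
    by (simp add: laplace_fun_def g_def)
  also have "\<dots> = vertex_sum ?E g v + vertex_sum ?E g w"
    unfolding ve[symmetric] by (rule sum.union_disjoint) (use fin eq in auto)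
  finally show ?thesis unfolding vs vw(1) edge_sum_pair[OF vw(2)] by (simp add: algebra_simps)
qed

text \<open>\<open>GREATEST\<close> is meaningful only with a bound on the exponents: the degree sum
  of an edge is positive, so \<open>k < p ^ k\<close> bounds \<open>k\<close> by it.\<close>

lemma dvd_degree_sum:
  assumes G: "simple_graph G" and p: "prime p" and e: "e \<in> edges G"
  shows "int (p ^ degree_sum_exponent G p) dvd edge_sum (\<lambda>v. int (vdegree G v)) e"
proof -
  define P where "P = (\<lambda>k. \<forall>v w. {v, w} \<in> edges G \<longrightarrow> p ^ k dvd vdegree G v + vdegree G w)"
  have "card e = 2" using G e by (simp add: simple_graph_def)
  then obtain v w where vw: "e = {v, w}" "v \<noteq> w" by (auto simp: card_2_iff)
  have "finite {f \<in> edges G. v \<in> f}" "{f \<in> edges G. v \<in> f} \<noteq> {}"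
    using finite_edges[OF G] e vw by auto
  then have pos: "vdegree G v > 0" unfolding vdegree_def by (simp add: card_gt_0_iff)
  have bound: "k \<le> vdegree G v + vdegree G w" if "P k" for k
  proof -
    have "p ^ k dvd vdegree G v + vdegree G w" using that e vw by (simp add: P_def)
    then have "p ^ k \<le> vdegree G v + vdegree G w" using pos by (intro dvd_imp_le) auto
    moreover have "k < p ^ k" using prime_gt_1_nat[OF p] by (simp add: power_gt_expt)
    ultimately show ?thesis by linarith
  qed
  have "P 0" by (simp add: P_def)
  then have "P (Greatest P)" by (rule GreatestI_nat) (rule bound)
  moreover have "Greatest P = degree_sum_exponent G p" by (simp add: P_def degree_sum_exponent_def)
  ultimately have "P (degree_sum_exponent G p)" by simp
  then have "p ^ degree_sum_exponent G p dvd vdegree G v + vdegree G w" using e vw by (simp add: P_def)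
  then show ?thesis unfolding vw(1) edge_sum_pair[OF vw(2)] by (metis of_nat_add of_nat_dvd_iff)
qed

text \<open>The diagonal part is a multiple of \<open>q\<close> and is absorbed into
  \<open>w\<close>; the opposite sign of the Gram part is absorbed by negating its argument.\<close>

lemma laplacian_lattice_line_graph:
  assumes G: "simple_graph G"
    and q: "\<And>e. e \<in> edges G \<Longrightarrow> int q dvd edge_sum (\<lambda>v. int (vdegree G v)) e"
  shows "{x. \<exists>y w. \<forall>e\<in>edges G. x e = laplace_fun (line_graph G) y e + int q * w e}
    = {\<lambda>e. x e + int q * w e | x w. x \<in> gram_image (edges G)}"
proof -
  let ?E = "edges G"
  obtain k where k: "\<And>e. e \<in> ?E \<Longrightarrow> edge_sum (\<lambda>v. int (vdegree G v)) e = int q * k e"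
    using bchoice[of "edges G" "\<lambda>e k. edge_sum (\<lambda>v. int (vdegree G v)) e = int q * k"] q
    by (auto simp: dvd_def)
  have lap: "laplace_fun (line_graph G) y e = int q * (k e * y e) - edge_sum (vertex_sum ?E y) e"
    if "e \<in> ?E" for y e
    unfolding laplace_fun_line_graph[OF G that] k[OF that] by simp
  have neg: "edge_sum (vertex_sum ?E (\<lambda>e. - z e)) e = - edge_sum (vertex_sum ?E z) e" for z :: "'a set \<Rightarrow> int" and e
    by (simp add: vertex_sum_def edge_sum_def sum_negf)
  show ?thesis
  proof (intro equalityI subsetI)
    fix x assume "x \<in> {x. \<exists>y w. \<forall>e\<in>?E. x e = laplace_fun (line_graph G) y e + int q * w e}"
    then obtain y w where x: "\<And>e. e \<in> ?E \<Longrightarrow> x e = laplace_fun (line_graph G) y e + int q * w e" by blast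
    define w' where "w' = (\<lambda>e. k e * y e + w e)"
    have "(\<lambda>e. x e - int q * w' e) \<in> gram_image ?E"
      unfolding gram_image_def
      by (intro CollectI exI[of _ "\<lambda>e. - y e"] ballI)
        (simp add: x lap neg w'_def algebra_simps)
    then show "x \<in> {\<lambda>e. x e + int q * w e | x w. x \<in> gram_image ?E}"
      by (intro CollectI exI[of _ "\<lambda>e. x e - int q * w' e"] exI[of _ w']) simp
  next
    fix x assume "x \<in> {\<lambda>e. x e + int q * w e | x w. x \<in> gram_image ?E}"
    then obtain x' w z where x: "x = (\<lambda>e. x' e + int q * w e)"
      and z: "\<And>e. e \<in> ?E \<Longrightarrow> x' e = edge_sum (vertex_sum ?E z) e"
      by (auto simp: gram_image_def)
    show "x \<in> {x. \<exists>y w. \<forall>e\<in>?E. x e = laplace_fun (line_graph G) y e + int q * w e}"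
      by (intro CollectI exI[of _ "\<lambda>e. - z e"] exI[of _ "\<lambda>e. w e + k e * z e"] ballI)
        (simp add: x z lap neg algebra_simps)
  qed
qed

text \<open>The free coordinate \<open>i0\<close> has modulus \<open>gcd q 0 = q\<close> after
  reduction, so it can be cancelled against the coordinate sum. The indicator of \<open>e0\<close>
  is a vector of degree 1.\<close>

lemma quotient_critical_line_graph_iso:
  assumes G: "simple_graph G" "connected_graph G"
    and p: "prime p" and k: "degree_sum_exponent G p \<ge> 1" and q: "q = p ^ degree_sum_exponent G p"
    and P: "presents UNIV (gram_image (edges G)) I m f" and i0: "i0 \<in> I" "m i0 = 0"
    and ne: "e0 \<in> edges G"
  shows "quotient_by_multiples (critical_group (line_graph G)) q
    \<cong> product_group (I - {i0}) (\<lambda>i. integer_mod_group (gcd q (m i)))"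
proof -
  let ?E = "edges G"
  let ?\<Lambda> = "{x. \<exists>y w. \<forall>e\<in>?E. x e = laplace_fun (line_graph G) y e + int q * w e}"
  have q0: "q > 0" using p by (simp add: q prime_gt_0_nat)
  note L = simple_line_graph[OF G(1)]
  have conn: "connected_graph (line_graph G)" using connected_line_graph[OF G] ne by blast
  have fin: "finite ?E" by (rule finite_edges[OF G(1)])
  have P': "presents UNIV ?\<Lambda> I (\<lambda>i. gcd q (m i)) f"
    using presents_mod[OF P, of q] dvd_degree_sum[OF G(1) p]
    unfolding q by (simp only: laplacian_lattice_line_graph[OF G(1)])
  have "\<exists>g. presents {x. (\<Sum>e\<in>?E. x e) = 0} ?\<Lambda> (I - {i0}) (\<lambda>i. gcd q (m i)) g"
  proof (rule presents_cancel[OF P' i0(1) _ _ p q k])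
    show "int_linear (\<lambda>x. \<Sum>e\<in>?E. x e)"
      by (simp add: int_linear_def sum.distrib sum_distrib_left)
    show "(\<Sum>e\<in>?E. of_bool (e = e0)) = (1 :: int)"
    proof -
      have "?E \<inter> {e. e = e0} = {e0}" using ne by auto
      then show ?thesis using fin ne by (simp add: of_bool_def sum.If_cases)
    qed
    fix x assume "x \<in> ?\<Lambda>"
    then obtain y w where x: "\<And>e. e \<in> ?E \<Longrightarrow> x e = laplace_fun (line_graph G) y e + int q * w e" by blast
    have "(\<Sum>e\<in>?E. x e) = (\<Sum>e\<in>?E. laplace_fun (line_graph G) y e) + int q * (\<Sum>e\<in>?E. w e)"
      unfolding sum_distrib_left sum.distrib[symmetric] by (rule sum.cong) (simp_all add: x)
    then show "int q dvd (\<Sum>e\<in>?E. x e)" using sum_laplace_fun[OF L, of y] by simp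
  qed (use i0 in auto)
  then obtain g where "presents {x. (\<Sum>e\<in>?E. x e) = 0} ?\<Lambda> (I - {i0}) (\<lambda>i. gcd q (m i)) g" by blast
  then show ?thesis
    using quotient_critical_group_iso[OF L conn q0, of "I - {i0}" "\<lambda>i. gcd q (m i)" g] q0
    by simp
qed

section \<open>Bipartiteness through signs, and assembly of the cases\<close>

lemma DirProd_trivial_group_iso:
  assumes "trivial_group H" shows "G \<times>\<times> H \<cong> G"
proof -
  have H: "carrier H = {\<one>\<^bsub>H\<^esub>}" using assms by (simp add: trivial_group_def)
  have "fst \<in> iso (G \<times>\<times> H) G"
  proof (rule isoI)
    show "fst \<in> hom (G \<times>\<times> H) G" by (rule homI) (auto simp: DirProd_def)
    show "bij_betw fst (carrier (G \<times>\<times> H)) (carrier G)"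
      by (rule bij_betwI[where g = "\<lambda>x. (x, \<one>\<^bsub>H\<^esub>)"]) (auto simp: H)
  qed
  then show ?thesis by (auto simp: is_iso_def)
qed

text \<open>A bipartition gives signs that alternate on the tree, hence agree with \<open>s\<close>
  up to a global sign; so \<open>s\<close> alone decides.\<close>

lemma bipartite_iff_balanced:
  assumes T: "tree_potential (vertices G) (edges G) T r s Y"
  shows "bipartite_graph G \<longleftrightarrow> (\<forall>e\<in>edges G. edge_sum s e = 0)"
proof -
  interpret tree_potential "vertices G" "edges G" T r s Y by (rule T)
  show ?thesis
  proof
    assume "bipartite_graph G"
    then obtain A B where AB: "A \<union> B = vertices G" "A \<inter> B = {}"
      "\<forall>e\<in>edges G. \<exists>a\<in>A. \<exists>b\<in>B. e = {a, b}" unfolding bipartite_graph_def by (elim exE conjE)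
    define t where "t = (\<lambda>v. if v \<in> A then 1 else - 1 :: int)"
    have t0: "edge_sum t e = 0" if e: "e \<in> edges G" for e
    proof -
      obtain a b where ab: "a \<in> A" "b \<in> B" "e = {a, b}" using AB(3)[rule_format, OF e] by (elim bexE)
      then have "b \<notin> A" using AB(2) by (metis disjoint_iff)
      then have "a \<noteq> b" using ab(1) by metis
      then show ?thesis using ab \<open>b \<notin> A\<close> by (simp add: t_def)
    qed
    have tT: "edge_sum t e = 0" if "e \<in> T" for e using t0 TE that by blast
    have st: "t v = t r * s v" if "v \<in> vertices G" for v
      by (rule rooted_tree_alternating[where y = t, OF tree tT s_tree s_root that])
    show "\<forall>e\<in>edges G. edge_sum s e = 0"
    proof
      fix e assume e: "e \<in> edges G"
      have "edge_sum t e = edge_sum (\<lambda>v. t r * s v) e" by (rule edge_sum_cong_V[OF e st])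
      also have "\<dots> = t r * edge_sum s e" using edge_sum_linear[of "t r" s 0 s e] by simp
      finally have "t r * edge_sum s e = 0" using t0[OF e] by metis
      moreover have "t r \<noteq> 0" by (simp add: t_def)
      ultimately show "edge_sum s e = 0" by simp
    qed
  next
    assume bal: "\<forall>e\<in>edges G. edge_sum s e = 0"
    let ?A = "{v \<in> vertices G. s v = 1}" and ?B = "{v \<in> vertices G. s v = - 1}"
    have "\<exists>a\<in>?A. \<exists>b\<in>?B. e = {a, b}" if e: "e \<in> edges G" for e
    proof -
      obtain v w where vw: "e = {v, w}" "v \<noteq> w" using E[OF e] by (auto simp: card_2_iff)
      have V: "v \<in> vertices G" "w \<in> vertices G" using E[OF e] vw by auto
      have "edge_sum s e = 0" using bal e by blast
      then have "s v + s w = 0" unfolding vw(1) edge_sum_pair[OF vw(2)] .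
      then consider "s v = 1" "s w = - 1" | "s v = - 1" "s w = 1" using s_pm[OF V(1)] by linarith
      then show ?thesis
      proof cases
        case 1
        then show ?thesis using V vw(1) by (intro bexI[of _ v] bexI[of _ w]) simp_all
      next
        case 2
        have "e = {w, v}" unfolding vw(1) by (rule insert_commute)
        with 2 show ?thesis using V by (intro bexI[of _ w] bexI[of _ v]) simp_all
      qed
    qed
    moreover have "?A \<union> ?B = vertices G" "?A \<inter> ?B = {}" using s_pm by auto
    ultimately show "bipartite_graph G"
      unfolding bipartite_graph_def by (intro exI[of _ ?A] exI[of _ ?B] conjI ballI)
  qed
qed

theorem theorem1p2:
  fixes G :: "'a sgraph" and p :: nat
  assumes "simple_graph G"
    and "connected_graph G"
    and "\<exists>c. is_cycle G c \<and> even (length c)"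
    and "prime p"
    and "degree_sum_exponent G p \<ge> 1"
  shows "let K = critical_group (line_graph G);
             q = p ^ degree_sum_exponent G p;
             \<beta> = cyclomatic_number G;
             n = card (vertices G)
         in
           (bipartite_graph G \<longrightarrow>
              quotient_by_multiples K q
                \<cong> cyclic_power q (\<beta> - 1) \<times>\<times> integer_mod_group (gcd q n)) \<and>
           (\<not> bipartite_graph G \<longrightarrow>
              (odd p \<longrightarrow>
                 quotient_by_multiples K q \<cong> cyclic_power q (\<beta> - 2)) \<and>
              (p = 2 \<and> even n \<longrightarrow>
                 quotient_by_multiples K q \<cong> cyclic_power q (\<beta> - 2) \<times>\<times> cyclic_power 2 2) \<and>
              (p = 2 \<and> odd n \<longrightarrow>
                 quotient_by_multiples K q
                   \<cong> cyclic_power q (\<beta> - 2) \<times>\<times> integer_mod_group (gcd q 4)))"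
proof -
  let ?V = "vertices G" and ?E = "edges G"
  define K where "K = critical_group (line_graph G)"
  define q where "q = p ^ degree_sum_exponent G p"
  define \<beta> where "\<beta> = cyclomatic_number G"
  have fin: "finite ?E" by (rule finite_edges[OF assms(1)])
  obtain r where r: "r \<in> ?V" using assms(2) by (auto simp: connected_graph_def)
  obtain T where T: "rooted_tree r ?V T" "T \<subseteq> ?E"
    using spanning_tree_exists[OF assms(1,2) r] by blast
  obtain Y where Y: "\<And>v. int_linear (\<lambda>x. Y x v)" "\<And>x. Y x r = 0"
    "\<And>x e. e \<in> T \<Longrightarrow> edge_sum (Y x) e = x e"
    using rooted_tree_potential[OF T(1)] by blast
  obtain s :: "'a \<Rightarrow> int" where s: "s r = 1" "\<And>v. v \<in> ?V \<Longrightarrow> s v = 1 \<or> s v = - 1"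
    "\<And>e. e \<in> T \<Longrightarrow> edge_sum s e = 0"
    using rooted_tree_signs[OF T(1)] by blast
  have tp: "tree_potential ?V ?E T r s Y"
    by unfold_locales (use fin T Y s assms(1) in \<open>auto simp: simple_graph_def\<close>)
  interpret tree_potential ?V ?E T r s Y by (rule tp)
  obtain z :: "'a set \<Rightarrow> int" where z: "\<exists>e\<in>?E. z e \<noteq> 0" "\<And>v. vertex_sum ?E z v = 0"
    using assms(3) even_cycle_alternating[OF _ fin] by blast
  \<comment> \<open>The incidence map is injective on the tree, so a nonzero kernel vector cannot be
    supported there. This provides the free coordinate to cancel.\<close>
  have z_off: "\<exists>e\<in>?E - T. z e \<noteq> 0"
  proof (rule ccontr)
    assume "\<not> ?thesis"
    then have off: "z e = 0" if "e \<in> ?E - T" for e using that by blast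
    have "vertex_sum T z v = 0" for v
      using vertex_sum_mono_neutral[OF fin T(2), of z v] off z(2) by simp
    then have "z e = 0" if "e \<in> T" for e using rooted_tree_vertex_sum_eq_0[OF T(1) _ that] by blast
    then show False using z(1) off by blast
  qed
  have \<beta>: "card (?E - T) = \<beta>" unfolding \<beta>_def by (rule cyclomatic_number_eq[OF assms(1) fin T, symmetric])
  note iso = quotient_critical_line_graph_iso[OF assms(1,2,4,5) q_def, folded K_def]
  have card_Some: "card (Some ` A) = card A" for A :: "'a set set" by (simp add: card_image)
  have bip: "bipartite_graph G \<longrightarrow> quotient_by_multiples K q
      \<cong> cyclic_power q (\<beta> - 1) \<times>\<times> integer_mod_group (gcd q (card ?V))"
  proof
    assume "bipartite_graph G"
    then have bal: "edge_sum s e = 0" if "e \<in> ?E" for e using bipartite_iff_balanced[OF tp] that by blast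
    obtain e0 where e0: "e0 \<in> ?E - T" using z_off by blast
    let ?J = "Some ` (?E - T - {e0})"
    let ?M = "\<lambda>i. gcd q (case i of None \<Rightarrow> card ?V | Some e \<Rightarrow> 0)"
    have J: "Some ` (?E - T) \<union> {None} - {Some e0} = ?J \<union> {None}" by auto
    have "quotient_by_multiples K q \<cong> product_group (?J \<union> {None}) (\<lambda>i. integer_mod_group (?M i))"
      using iso[OF presents_bipartite[OF bal], of "Some e0" e0] e0 unfolding J by simp
    also have "product_group (?J \<union> {None}) (\<lambda>i. integer_mod_group (?M i))
        \<cong> cyclic_power q (card ?J) \<times>\<times> integer_mod_group (gcd q (card ?V))"
    proof (rule product_group_cyclic_split)
      show "product_group {None} (\<lambda>i. integer_mod_group (?M i)) \<cong> integer_mod_group (gcd q (card ?V))"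
        using product_group_singleton[of "\<lambda>i. integer_mod_group (?M i)" None] by simp
    qed (use fin in auto)
    also have "card ?J = \<beta> - 1" using e0 fin by (simp add: card_Some \<beta>)
    finally show "quotient_by_multiples K q
      \<cong> cyclic_power q (\<beta> - 1) \<times>\<times> integer_mod_group (gcd q (card ?V))" .
  qed
  have nonbip: "(odd (card ?V) \<longrightarrow> quotient_by_multiples K q
        \<cong> cyclic_power q (\<beta> - 2) \<times>\<times> integer_mod_group (gcd q 4)) \<and>
      (even (card ?V) \<longrightarrow> quotient_by_multiples K q
        \<cong> cyclic_power q (\<beta> - 2) \<times>\<times> cyclic_power (gcd q 2) 2)" if nb: "\<not> bipartite_graph G"
  proof -
    obtain e1 where e1: "e1 \<in> ?E" "edge_sum s e1 \<noteq> 0" using nb bipartite_iff_balanced[OF tp] by blast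
    obtain v w where vw: "e1 = {v, w}" "v \<noteq> w" using E[OF e1(1)] by (auto simp: card_2_iff)
    have "v \<in> ?V" "w \<in> ?V" using E[OF e1(1)] vw by auto
    then have s1: "edge_sum s e1 = 2 * s v" "s v = 1 \<or> s v = - 1"
      using s_pm[of v] s_pm[of w] e1(2) vw by auto
    have e1T: "e1 \<notin> T" using e1(2) s_tree by blast
    \<comment> \<open>The edge \<open>e1\<close> is not a free coordinate, so another edge off the
      tree is needed. If \<open>z\<close> lived on \<open>T\<close> and \<open>e1\<close> only,
      pairing with \<open>s\<close> would leave just the term of \<open>e1\<close> and force
      \<open>z e1 = 0\<close>.\<close>
    have "\<exists>e\<in>?E - T - {e1}. z e \<noteq> 0"
    proof (rule ccontr)
      assume "\<not> ?thesis"
      then have off: "z e = 0" if "e \<in> ?E - T - {e1}" for e using that by blast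
      have "0 = (\<Sum>e\<in>?E. edge_sum s e * z e)"
        unfolding sum_vertex_sum_V[symmetric] by (simp add: z(2))
      also have "\<dots> = (\<Sum>e\<in>{e1}. edge_sum s e * z e)"
        by (rule sum.mono_neutral_right) (use fin e1 off s_tree in auto)
      finally have "z e1 = 0" using e1(2) by simp
      then show False using z_off off by blast
    qed
    then obtain e0 where e0: "e0 \<in> ?E - T - {e1}" by blast
    let ?J = "Some ` (?E - T - {e1} - {e0})"
    \<comment> \<open>\<open>e0\<close> and \<open>e1\<close> are distinct edges off the tree, so
      \<beta> is at least 2 and the subtraction is not truncated.\<close>
    have cardJ: "card ?J = \<beta> - 2"
      using e0 e1(1) e1T fin by (simp add: card_Some \<beta>)
    have "quotient_by_multiples K q \<cong> cyclic_power q (\<beta> - 2) \<times>\<times> integer_mod_group (gcd q 4)"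
      if odd: "odd (card ?V)"
    proof -
      let ?M = "\<lambda>i. gcd q (case i of None \<Rightarrow> 4 | Some e \<Rightarrow> 0)"
      have J: "Some ` (?E - T - {e1}) \<union> {None} - {Some e0} = ?J \<union> {None}" by auto
      have "quotient_by_multiples K q \<cong> product_group (?J \<union> {None}) (\<lambda>i. integer_mod_group (?M i))"
        using iso[OF presents_odd[OF e1(1) s1 odd], of "Some e0" e0] e0 unfolding J by simp
      also have "product_group (?J \<union> {None}) (\<lambda>i. integer_mod_group (?M i))
          \<cong> cyclic_power q (card ?J) \<times>\<times> integer_mod_group (gcd q 4)"
      proof (rule product_group_cyclic_split)
        show "product_group {None} (\<lambda>i. integer_mod_group (?M i)) \<cong> integer_mod_group (gcd q 4)"
          using product_group_singleton[of "\<lambda>i. integer_mod_group (?M i)" None] by simp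
      qed (use fin in auto)
      finally show ?thesis unfolding cardJ .
    qed
    moreover have "quotient_by_multiples K q \<cong> cyclic_power q (\<beta> - 2) \<times>\<times> cyclic_power (gcd q 2) 2"
      if even: "even (card ?V)"
    proof -
      let ?M = "\<lambda>i. gcd q (case i of None \<Rightarrow> 2 | Some e \<Rightarrow> if e = e1 then 2 else 0)"
      have J: "Some ` (?E - T - {e1}) \<union> {Some e1, None} - {Some e0} = ?J \<union> {Some e1, None}"
        using e0 by auto
      have "quotient_by_multiples K q
          \<cong> product_group (?J \<union> {Some e1, None}) (\<lambda>i. integer_mod_group (?M i))"
        using iso[OF presents_even[OF e1(1) s1 even], of "Some e0" e0] e0 unfolding J by simp
      also have "product_group (?J \<union> {Some e1, None}) (\<lambda>i. integer_mod_group (?M i))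
          \<cong> cyclic_power q (card ?J) \<times>\<times> cyclic_power (gcd q 2) 2"
      proof (rule product_group_cyclic_split)
        show "product_group {Some e1, None} (\<lambda>i. integer_mod_group (?M i)) \<cong> cyclic_power (gcd q 2) 2"
        proof -
          have "card {Some e1, None} = 2" by simp
          moreover have "product_group {Some e1, None} (\<lambda>i. integer_mod_group (?M i))
              \<cong> cyclic_power (gcd q 2) (card {Some e1, None})"
            by (rule product_group_eq_cyclic_power) auto
          ultimately show ?thesis by (simp only:)
        qed
        show "?M j = q" if "j \<in> ?J" for j
        proof -
          obtain e where "j = Some e" "e \<noteq> e1" using \<open>j \<in> ?J\<close> by blast
          then show ?thesis by simp
        qed
        show "?J \<inter> {Some e1, None} = {}" by blast
      qed (use fin in simp)
      finally show ?thesis unfolding cardJ .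
    qed
    ultimately show ?thesis by blast
  qed
  have nonbip_odd: "quotient_by_multiples K q \<cong> cyclic_power q (\<beta> - 2)"
    if nb: "\<not> bipartite_graph G" and p: "odd p"
  proof -
    \<comment> \<open>For odd \<open>p\<close> the finite factors of both parities reduce to trivial
      groups modulo \<open>q\<close>.\<close>
    have q2: "coprime q 2" using p by (simp add: q_def)
    then have "coprime q (2 * 2)" by (simp only: coprime_mult_right_iff)
    then have q1: "gcd q 4 = 1" "gcd q 2 = 1" using q2 by simp_all
    show ?thesis
    proof (cases "even (card ?V)")
      case True
      then have "quotient_by_multiples K q \<cong> cyclic_power q (\<beta> - 2) \<times>\<times> cyclic_power 1 2"
        using nonbip[OF nb] unfolding q1 by blast
      also have "\<dots> \<cong> cyclic_power q (\<beta> - 2)"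
        by (rule DirProd_trivial_group_iso)
          (simp add: cyclic_power_def trivial_product_group trivial_integer_mod_group)
      finally show ?thesis .
    next
      case False
      then have "quotient_by_multiples K q \<cong> cyclic_power q (\<beta> - 2) \<times>\<times> integer_mod_group 1"
        using nonbip[OF nb] unfolding q1 by blast
      also have "\<dots> \<cong> cyclic_power q (\<beta> - 2)"
        by (rule DirProd_trivial_group_iso) (simp add: trivial_integer_mod_group)
      finally show ?thesis .
    qed
  qed
  have gcd2: "gcd q 2 = 2" if "p = 2" using that assms(5) by (simp add: q_def gcd_nat.absorb2)
  have nonbip_even: "quotient_by_multiples K q \<cong> cyclic_power q (\<beta> - 2) \<times>\<times> cyclic_power 2 2"
    if "\<not> bipartite_graph G" "p = 2" "even (card ?V)"
    using nonbip[OF that(1)] that(3) unfolding gcd2[OF that(2)] by blast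
  show ?thesis
    unfolding Let_def K_def[symmetric] q_def[symmetric] \<beta>_def[symmetric]
    using bip nonbip nonbip_odd nonbip_even by blast
qed

end
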